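(* Let $(X,\rho)$ be a computably second countable represented space, let $Y\subseteq X$, and equip $Y$ with the restricted representation $\rho_{|Y}$. Then $(Y,\rho_{|Y})$ is computably second countable, and $Y$ is a computably sequential subset of $(X,\rho)$.
   Context: A represented space $(X,\rho)$ is a set with a partial surjection $\rho:\subseteq\mathbb{N}^{\mathbb{N}}\to X$; computability of maps is via computable realizers on names; $X$ carries the final topology of $\rho$. $\mathcal{O}(X)$ denotes the open sets represented by $[\rho\to c_{\mathbb{S}}]$: an open set is identified with its characteristic map into Sierpiński space $\mathbb{S}=\{0,1\}$ (represented by $c_{\mathbb{S}}(0^\omega)=0$, $c_{\mathbb{S}}(p)=1$ otherwise) and named by a name of that continuous map (a Type-2 machine code plus oracle). An $\mathcal{O}(\mathbb{N})$-name of a subset of $\mathbb{N}$ is equivalently an enumeration of it. $(X,\rho)$ is computably second countable if there is a sequence $(B_i)_{i\in\mathbb{N}}$ of subsets of $X$ forming a classical subbase of its topology, with every point in some $B_i$ and $x\mapsto\{i:x\in B_i\}$ injective, such that $\rho$ is computably equivalent to the representation whose names of $x$ are $\mathcal{O}(\mathbb{N})$-names of $\{i: x\in B_i\}$. $Y\subseteq X$ is a computably sequential subset of $(X,\rho)$ if the following two representations of open sets of $Y$ are computably equivalent: $[\rho_{|Y}\to c_{\mathbb{S}}]$, and $\tau$ given by $\tau(p)=[\rho\to c_{\mathbb{S}}](p)\cap Y$. *)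

theory Defs
  imports "HOL-Analysis.Function_Topology" "HOL-Library.Nat_Bijection"
begin

type_synonym baire = "nat \<Rightarrow> nat"

text \<open>
  Programs for the partial recursive functions relative to an oracle. All functions are unary;
  several arguments are passed through the pairing \<^const>\<open>prod_encode\<close>.
\<close>

datatype prog =
    PZero
  | PSucc
  | PFst
  | PSnd
  | PQuery
  | PPair prog prog
  | PComp prog prog
  | PPrec prog prog
  | PMu prog

text \<open>
  \<open>PPrec f g\<close> computes \<open>h (n, 0) = f n\<close>, \<open>h (n, m + 1) = g (n, (m, h (n, m)))\<close>.
  \<open>PMu f\<close> returns the least \<open>k\<close> with \<open>f (n, k) = 0\<close> such that all \<open>f (n, j)\<close>, \<open>j < k\<close>, are defined.
\<close>

primrec eval :: "baire \<Rightarrow> prog \<Rightarrow> nat \<rightharpoonup> nat" where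
  "eval q PZero = (\<lambda>n. Some 0)"
| "eval q PSucc = (\<lambda>n. Some (Suc n))"
| "eval q PFst = (\<lambda>n. Some (fst (prod_decode n)))"
| "eval q PSnd = (\<lambda>n. Some (snd (prod_decode n)))"
| "eval q PQuery = (\<lambda>n. Some (q n))"
| "eval q (PPair f g) = (\<lambda>n. Option.bind (eval q f n) (\<lambda>a.
     map_option (\<lambda>b. prod_encode (a, b)) (eval q g n)))"
| "eval q (PComp f g) = (\<lambda>n. Option.bind (eval q g n) (eval q f))"
| "eval q (PPrec f g) = (\<lambda>z. case prod_decode z of (n, m) \<Rightarrow>
     rec_nat (eval q f n)
       (\<lambda>k r. Option.bind r (\<lambda>v. eval q g (prod_encode (n, prod_encode (k, v))))) m)"
| "eval q (PMu f) = (\<lambda>n.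
     let halt = (\<lambda>k. eval q f (prod_encode (n, k)) = Some 0 \<and>
                     (\<forall>j<k. eval q f (prod_encode (n, j)) \<noteq> None))
     in if \<exists>k. halt k then Some (LEAST k. halt k) else None)"

primrec prog_code :: "prog \<Rightarrow> nat" where
  "prog_code PZero = prod_encode (0, 0)"
| "prog_code PSucc = prod_encode (1, 0)"
| "prog_code PFst = prod_encode (2, 0)"
| "prog_code PSnd = prod_encode (3, 0)"
| "prog_code PQuery = prod_encode (4, 0)"
| "prog_code (PPair f g) = prod_encode (5, prod_encode (prog_code f, prog_code g))"
| "prog_code (PComp f g) = prod_encode (6, prod_encode (prog_code f, prog_code g))"
| "prog_code (PPrec f g) = prod_encode (7, prod_encode (prog_code f, prog_code g))"
| "prog_code (PMu f) = prod_encode (8, prog_code f)"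

lemma prog_code_eq_iff: "prog_code e = prog_code e' \<longleftrightarrow> e = e'"
proof (induction e arbitrary: e')
  case PZero show ?case by (cases e') (simp_all add: prod_encode_eq)
next
  case PSucc show ?case by (cases e') (simp_all add: prod_encode_eq)
next
  case PFst show ?case by (cases e') (simp_all add: prod_encode_eq)
next
  case PSnd show ?case by (cases e') (simp_all add: prod_encode_eq)
next
  case PQuery show ?case by (cases e') (simp_all add: prod_encode_eq)
next
  case (PPair f g) then show ?case by (cases e') (simp_all add: prod_encode_eq)
next
  case (PComp f g) then show ?case by (cases e') (simp_all add: prod_encode_eq)
next
  case (PPrec f g) then show ?case by (cases e') (simp_all add: prod_encode_eq)
next
  case (PMu f) then show ?case by (cases e') (simp_all add: prod_encode_eq)
qed

lemma inj_prog_code: "inj prog_code"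
  by (simp add: inj_def prog_code_eq_iff)

text \<open>
  The partial function on Baire space computed by a program: the input is the oracle, and the
  \<open>k\<close>-th output symbol is the result on argument \<open>k\<close>. It is defined at exactly those inputs
  for which every output symbol is eventually produced.
\<close>

definition type2 :: "prog \<Rightarrow> baire \<rightharpoonup> baire" where
  "type2 e p =
     (if \<forall>k. eval p e k \<noteq> None then Some (\<lambda>k. the (eval p e k)) else None)"

definition join :: "baire \<Rightarrow> baire \<Rightarrow> baire" where
  "join p q = (\<lambda>n. if even n then p (n div 2) else q (n div 2))"

text \<open>
  The partial continuous function with name \<open>p\<close>: \<open>p 0\<close> is a machine code and the rest
  of \<open>p\<close> is an oracle that the machine reads alongside its input.
\<close>

definition eta :: "baire \<Rightarrow> baire \<rightharpoonup> baire" where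
  "eta p x =
     (if p 0 \<in> range prog_code
      then type2 (inv prog_code (p 0)) (join (\<lambda>n. p (Suc n)) x) else None)"

type_synonym 'a repr = "baire \<rightharpoonup> 'a"

definition represented_space :: "'a set \<Rightarrow> 'a repr \<Rightarrow> bool" where
  "represented_space X \<rho> \<longleftrightarrow> ran \<rho> = X"

definition realizes :: "'a repr \<Rightarrow> 'b repr \<Rightarrow> (baire \<rightharpoonup> baire) \<Rightarrow> ('a \<Rightarrow> 'b) \<Rightarrow> bool" where
  "realizes \<rho> \<delta> F f \<longleftrightarrow>
     (\<forall>p x. \<rho> p = Some x \<longrightarrow> (\<exists>q. F p = Some q \<and> \<delta> q = Some (f x)))"

definition computable_map :: "'a repr \<Rightarrow> 'b repr \<Rightarrow> ('a \<Rightarrow> 'b) \<Rightarrow> bool" where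
  "computable_map \<rho> \<delta> f \<longleftrightarrow> (\<exists>e. realizes \<rho> \<delta> (type2 e) f)"

definition repr_reducible :: "'a repr \<Rightarrow> 'a repr \<Rightarrow> bool" where
  "repr_reducible \<rho> \<delta> \<longleftrightarrow> computable_map \<rho> \<delta> (\<lambda>x. x)"

definition repr_equivalent :: "'a repr \<Rightarrow> 'a repr \<Rightarrow> bool" where
  "repr_equivalent \<rho> \<delta> \<longleftrightarrow> repr_reducible \<rho> \<delta> \<and> repr_reducible \<delta> \<rho>"

definition repr_restrict :: "'a repr \<Rightarrow> 'a set \<Rightarrow> 'a repr" where
  "repr_restrict \<rho> Y = \<rho> |` {p. \<exists>y\<in>Y. \<rho> p = Some y}"

definition final_topology :: "'a repr \<Rightarrow> 'a topology" where
  "final_topology \<rho> = topology (\<lambda>U. U \<subseteq> ran \<rho> \<and>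
     openin (top_of_set (dom \<rho>)) {p. \<exists>x\<in>U. \<rho> p = Some x})"

lemma openin_final_topology:
  "openin (final_topology \<rho>) U \<longleftrightarrow>
     U \<subseteq> ran \<rho> \<and> openin (top_of_set (dom \<rho>)) {p. \<exists>x\<in>U. \<rho> p = Some x}"
proof -
  let ?pre = "\<lambda>U. {p. \<exists>x\<in>U. \<rho> p = Some x}"
  let ?L = "\<lambda>U. U \<subseteq> ran \<rho> \<and> openin (top_of_set (dom \<rho>)) (?pre U)"
  have "?L (S \<inter> T)" if "?L S" "?L T" for S T
  proof -
    have "?pre (S \<inter> T) = ?pre S \<inter> ?pre T" by auto
    with that show ?thesis by (auto intro: openin_Int)
  qed
  moreover have "?L (\<Union>K)" if "\<forall>S\<in>K. ?L S" for K
  proof -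
    have "?pre (\<Union>K) = \<Union>(?pre ` K)" by auto
    moreover have "openin (top_of_set (dom \<rho>)) (\<Union>(?pre ` K))"
      using that by (intro openin_Union) auto
    ultimately show ?thesis using that by auto
  qed
  ultimately have "istopology ?L"
    unfolding istopology_def by blast
  then show ?thesis
    unfolding final_topology_def by (simp add: topology_inverse')
qed

definition repr_of :: "(baire \<Rightarrow> 'a \<Rightarrow> bool) \<Rightarrow> 'a repr" where
  "repr_of R p = (if \<exists>!x. R p x then Some (THE x. R p x) else None)"

lemma repr_of_eq_Some_iff:
  assumes "\<And>x y. R p x \<Longrightarrow> R p y \<Longrightarrow> x = y"
  shows "repr_of R p = Some x \<longleftrightarrow> R p x"
proof
  assume *: "repr_of R p = Some x"
  then have ex: "\<exists>!x. R p x"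
    unfolding repr_of_def by (metis option.distinct(1))
  have "repr_of R p = Some (THE x. R p x)"
    unfolding repr_of_def using ex by (rule if_P)
  with * have "(THE x. R p x) = x" by (metis option.inject)
  with theI'[OF ex] show "R p x" by metis
next
  assume R: "R p x"
  then have "\<exists>!x. R p x" using assms by blast
  then have "repr_of R p = Some (THE x. R p x)"
    unfolding repr_of_def by (rule if_P)
  moreover have "(THE x. R p x) = x"
    using R by (rule the_equality) (rule assms[OF _ R])
  ultimately show "repr_of R p = Some x" by metis
qed

text \<open>
  The function space representation. A map with domain \<^term>\<open>ran \<rho>\<close> is encoded as
  an element of \<^const>\<open>extensional\<close>, so that it is determined by its realizers.
\<close>

definition fun_repr :: "'a repr \<Rightarrow> 'b repr \<Rightarrow> ('a \<Rightarrow> 'b) repr" where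
  "fun_repr \<rho> \<delta> = repr_of (\<lambda>p f. f \<in> extensional (ran \<rho>) \<and> realizes \<rho> \<delta> (eta p) f)"

lemma fun_repr_eq_Some_iff:
  "fun_repr \<rho> \<delta> p = Some f \<longleftrightarrow> f \<in> extensional (ran \<rho>) \<and> realizes \<rho> \<delta> (eta p) f"
proof -
  let ?R = "\<lambda>f. f \<in> extensional (ran \<rho>) \<and> realizes \<rho> \<delta> (eta p) f"
  have uniq: "f = g" if "?R f" "?R g" for f g
  proof (rule extensionalityI)
    show "f \<in> extensional (ran \<rho>)" "g \<in> extensional (ran \<rho>)" using that by auto
    show "f x = g x" if "x \<in> ran \<rho>" for x
    proof -
      from that obtain q where q: "\<rho> q = Some x" by (auto simp: ran_def)
      have "realizes \<rho> \<delta> (eta p) f" "realizes \<rho> \<delta> (eta p) g"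
        using \<open>?R f\<close> \<open>?R g\<close> by simp_all
      then obtain r s where "eta p q = Some r" "\<delta> r = Some (f x)"
        "eta p q = Some s" "\<delta> s = Some (g x)"
        unfolding realizes_def using q by blast
      then show ?thesis by simp
    qed
  qed
  then show ?thesis
    unfolding fun_repr_def by (rule repr_of_eq_Some_iff)
qed

text \<open>Sierpinski space is \<^typ>\<open>bool\<close>, with \<^term>\<open>True\<close> as its open point.\<close>

definition sierpinski_repr :: "bool repr" where
  "sierpinski_repr p = Some (p \<noteq> (\<lambda>_. 0))"

definition nat_repr :: "nat repr" where
  "nat_repr p = Some (p 0)"

definition open_repr :: "'a repr \<Rightarrow> 'a set repr" where
  "open_repr \<rho> p = map_option (\<lambda>f. {x \<in> ran \<rho>. f x}) (fun_repr \<rho> sierpinski_repr p)"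

definition subbase_repr :: "'a set \<Rightarrow> (nat \<Rightarrow> 'a set) \<Rightarrow> 'a repr" where
  "subbase_repr X B =
     repr_of (\<lambda>p x. x \<in> X \<and> open_repr nat_repr p = Some {i. x \<in> B i})"

lemma subbase_repr_eq_Some_iff:
  assumes "inj_on (\<lambda>x. {i. x \<in> B i}) X"
  shows "subbase_repr X B p = Some x \<longleftrightarrow>
           x \<in> X \<and> open_repr nat_repr p = Some {i. x \<in> B i}"
  unfolding subbase_repr_def
proof (rule repr_of_eq_Some_iff)
  show "x = y" if "x \<in> X \<and> open_repr nat_repr p = Some {i. x \<in> B i}"
    "y \<in> X \<and> open_repr nat_repr p = Some {i. y \<in> B i}" for x y
    using that inj_onD[OF assms, of x y] by simp
qed

definition computably_second_countable :: "'a set \<Rightarrow> 'a repr \<Rightarrow> bool" where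
  "computably_second_countable X \<rho> \<longleftrightarrow>
     represented_space X \<rho> \<and>
     (\<exists>B :: nat \<Rightarrow> 'a set.
        (\<forall>i. B i \<subseteq> X) \<and>
        final_topology \<rho> = topology_generated_by (range B) \<and>
        (\<forall>x\<in>X. \<exists>i. x \<in> B i) \<and>
        inj_on (\<lambda>x. {i. x \<in> B i}) X \<and>
        repr_equivalent \<rho> (subbase_repr X B))"

definition computably_sequential_subset :: "'a set \<Rightarrow> 'a set \<Rightarrow> 'a repr \<Rightarrow> bool" where
  "computably_sequential_subset Y X \<rho> \<longleftrightarrow>
     represented_space X \<rho> \<and> Y \<subseteq> X \<and>
     repr_equivalent
       (open_repr (repr_restrict \<rho> Y))
       (\<lambda>p. map_option (\<lambda>U. U \<inter> Y) (open_repr \<rho> p))"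

end

theory Submission
  imports Defs
begin

text \<open>
  On a computably second countable space, names may be taken to be enumerations of the indices of
  the subbasic sets containing a point, and every finite sequence of such indices is a prefix of a
  name. Hence an open subset of \<open>Y\<close> that contains \<open>x\<close> contains all points of \<open>Y\<close> in some finite
  intersection of subbasic neighbourhoods of \<open>x\<close>, which identifies the topology of \<open>Y\<close>.

  If a machine recognises an open \<open>V \<subseteq> Y\<close>, let \<open>U\<close> be the set of all \<open>x \<in> X\<close> for which it accepts some
  sequence of indices of sets containing \<open>x\<close>, whether or not this sequence is a name. Acceptance uses
  a finite prefix, which for \<open>x \<in> Y\<close> extends to a name of \<open>x\<close>, so \<open>U \<inter> Y = V\<close>. Off \<open>Y\<close> the machine
  may diverge or depend on the name; dovetailing over all sequences and step bounds with a
  universal machine makes the recognition of \<open>U\<close> total and independent of the name.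
\<close>

abbreviation pair :: "nat \<Rightarrow> nat \<Rightarrow> nat" ("\<langle>_,/ _\<rangle>") where
  "\<langle>a, b\<rangle> \<equiv> prod_encode (a, b)"

abbreviation pfst :: "nat \<Rightarrow> nat" where "pfst n \<equiv> fst (prod_decode n)"
abbreviation psnd :: "nat \<Rightarrow> nat" where "psnd n \<equiv> snd (prod_decode n)"

section \<open>Total functions computable relative to an oracle\<close>

text \<open>A single program must serve all oracles in \<open>D\<close>. The restriction to
  \<open>D\<close> matters because a realizer need not halt on oracles that carry no name.\<close>

definition total_computable :: "baire set \<Rightarrow> (baire \<Rightarrow> nat \<Rightarrow> nat) \<Rightarrow> bool" where
  "total_computable D f \<longleftrightarrow> (\<exists>e. \<forall>Q\<in>D. \<forall>n. eval Q e n = Some (f Q n))"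

lemma total_computableI:
  "(\<And>Q n. Q \<in> D \<Longrightarrow> eval Q e n = Some (f Q n)) \<Longrightarrow> total_computable D f"
  unfolding total_computable_def by blast

lemma tc_id: "total_computable D (\<lambda>Q n. n)"
  \<comment> \<open>Pairing is a bijection, so splitting and re-pairing is the identity.\<close>
  by (rule total_computableI[where e = "PPair PFst PSnd"]) simp

lemma tc_const: "total_computable D (\<lambda>Q n. c)"
proof (induction c)
  case 0
  show ?case by (rule total_computableI[where e = PZero]) simp
next
  case (Suc c)
  then obtain e where "\<forall>Q\<in>D. \<forall>n. eval Q e n = Some c"
    unfolding total_computable_def by blast
  then show ?case by (intro total_computableI[where e = "PComp PSucc e"]) simp
qed

lemma tc_comp:
  assumes "total_computable D g" "total_computable D f"
  shows "total_computable D (\<lambda>Q n. g Q (f Q n))"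
proof -
  obtain e e' where "\<forall>Q\<in>D. \<forall>n. eval Q e n = Some (g Q n)" "\<forall>Q\<in>D. \<forall>n. eval Q e' n = Some (f Q n)"
    using assms unfolding total_computable_def by blast
  then show ?thesis by (intro total_computableI[where e = "PComp e e'"]) simp
qed

lemma tc_Suc: "total_computable D f \<Longrightarrow> total_computable D (\<lambda>Q n. Suc (f Q n))"
  by (rule tc_comp[of D "\<lambda>Q. Suc"], rule total_computableI[where e = PSucc]) simp_all

lemma tc_fst: "total_computable D f \<Longrightarrow> total_computable D (\<lambda>Q n. pfst (f Q n))"
  by (rule tc_comp[of D "\<lambda>Q. pfst"], rule total_computableI[where e = PFst]) simp_all

lemma tc_snd: "total_computable D f \<Longrightarrow> total_computable D (\<lambda>Q n. psnd (f Q n))"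
  by (rule tc_comp[of D "\<lambda>Q. psnd"], rule total_computableI[where e = PSnd]) simp_all

lemma tc_query: "total_computable D f \<Longrightarrow> total_computable D (\<lambda>Q n. Q (f Q n))"
  by (rule tc_comp[of D "\<lambda>Q. Q"], rule total_computableI[where e = PQuery]) simp_all

lemma tc_pair:
  assumes "total_computable D f" "total_computable D g"
  shows "total_computable D (\<lambda>Q n. \<langle>f Q n, g Q n\<rangle>)"
proof -
  obtain e e' where "\<forall>Q\<in>D. \<forall>n. eval Q e n = Some (f Q n)" "\<forall>Q\<in>D. \<forall>n. eval Q e' n = Some (g Q n)"
    using assms unfolding total_computable_def by blast
  then show ?thesis by (intro total_computableI[where e = "PPair e e'"]) simp
qed

text \<open>\<open>PPrec\<close> reads the iteration count from the second component of its
  argument; a computed count \<open>m Q n\<close> is supplied by composing with the map from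
  \<open>n\<close> to \<open>\<langle>n, m Q n\<rangle>\<close>.\<close>

lemma tc_rec:
  assumes "total_computable D f"
    and "total_computable D (\<lambda>Q z. g Q (pfst z) (pfst (psnd z)) (psnd (psnd z)))"
    and "total_computable D m"
  shows "total_computable D (\<lambda>Q n. rec_nat (f Q n) (g Q n) (m Q n))"
proof -
  obtain e1 e2 where e: "\<forall>Q\<in>D. \<forall>n. eval Q e1 n = Some (f Q n)"
    "\<forall>Q\<in>D. \<forall>z. eval Q e2 z = Some (g Q (pfst z) (pfst (psnd z)) (psnd (psnd z)))"
    using assms unfolding total_computable_def by blast
  have "rec_nat (Some (f Q n)) (\<lambda>k r. Option.bind r (\<lambda>v. eval Q e2 \<langle>n, \<langle>k, v\<rangle>\<rangle>)) j
    = Some (rec_nat (f Q n) (g Q n) j)" if "Q \<in> D" for Q n j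
    using that e(2) by (induction j) simp_all
  then have "total_computable D (\<lambda>Q z. rec_nat (f Q (pfst z)) (g Q (pfst z)) (psnd z))"
    using e(1) by (intro total_computableI[where e = "PPrec e1 e2"]) (simp split: prod.split)
  from tc_comp[OF this tc_pair[OF tc_id assms(3)]] show ?thesis by simp
qed

text \<open>A recursion whose step ignores counter and previous value only distinguishes a zero
  bound from a positive one.\<close>

lemma tc_if_zero:
  assumes "total_computable D f" "total_computable D a" "total_computable D b"
  shows "total_computable D (\<lambda>Q n. if f Q n = 0 then a Q n else b Q n)"
proof -
  have "(\<lambda>Q n. if f Q n = 0 then a Q n else b Q n)
      = (\<lambda>Q n. rec_nat (a Q n) (\<lambda>k r. b Q n) (f Q n))"
  proof (intro ext)
    show "(if f Q n = 0 then a Q n else b Q n) = rec_nat (a Q n) (\<lambda>k r. b Q n) (f Q n)" for Q n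
      by (cases "f Q n") simp_all
  qed
  then show ?thesis
    using assms tc_rec[OF assms(2) _ assms(1), of "\<lambda>Q n k r. b Q n"]
      tc_comp[OF assms(3) tc_fst[OF tc_id]] by simp
qed

lemma tc_pred:
  assumes "total_computable D f"
  shows "total_computable D (\<lambda>Q n. f Q n - 1)"
proof -
  have "rec_nat 0 (\<lambda>k r. k) m = m - 1" for m by (cases m) simp_all
  then show ?thesis
    using tc_rec[OF tc_const _ assms, of "\<lambda>Q n k r. k" 0] tc_fst[OF tc_snd[OF tc_id]] by simp
qed

lemma tc_diff:
  assumes "total_computable D f" "total_computable D g"
  shows "total_computable D (\<lambda>Q n. f Q n - g Q n)"
proof -
  have "rec_nat a (\<lambda>k r. r - 1) m = a - m" for a m :: nat by (induction m) simp_all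
  then show ?thesis
    using tc_rec[OF assms(1) _ assms(2), of "\<lambda>Q n k r. r - 1"]
      tc_pred[OF tc_snd[OF tc_snd[OF tc_id]]] by simp
qed

lemma tc_add:
  assumes "total_computable D f" "total_computable D g"
  shows "total_computable D (\<lambda>Q n. f Q n + g Q n)"
proof -
  have "rec_nat a (\<lambda>k r. Suc r) m = a + m" for a m :: nat by (induction m) simp_all
  then show ?thesis
    using tc_rec[OF assms(1) _ assms(2), of "\<lambda>Q n k r. Suc r"]
      tc_Suc[OF tc_snd[OF tc_snd[OF tc_id]]] by simp
qed

lemma tc_if_eq:
  assumes "total_computable D f" "total_computable D g"
    and "total_computable D a" "total_computable D b"
  shows "total_computable D (\<lambda>Q n. if f Q n = g Q n then a Q n else b Q n)"
proof -
  \<comment> \<open>Subtraction is truncated: both differences vanish only for equal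
    numbers.\<close>
  have "(x - y) + (y - x) = 0 \<longleftrightarrow> x = y" for x y :: nat by auto
  with tc_if_zero[OF tc_add[OF tc_diff[OF assms(1,2)] tc_diff[OF assms(2,1)]] assms(3,4)]
  show ?thesis by (simp only:)
qed

lemma tc_divmod_two:
  assumes "total_computable D f"
  shows "total_computable D (\<lambda>Q n. \<langle>f Q n div 2, f Q n mod 2\<rangle>)"
proof -
  \<comment> \<open>Counts up quotient and remainder as one pair; a remainder 1 wraps to 0 and the
    quotient grows.\<close>
  let ?g = "\<lambda>r. if psnd r = 0 then \<langle>pfst r, 1\<rangle> else \<langle>Suc (pfst r), 0\<rangle>"
  have "rec_nat \<langle>0, 0\<rangle> (\<lambda>k. ?g) m = \<langle>m div 2, m mod 2\<rangle>" for m
  proof (induction m)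
    case (Suc m)
    have "Suc m div 2 = (if m mod 2 = 0 then m div 2 else Suc (m div 2))"
      "Suc m mod 2 = (if m mod 2 = 0 then 1 else 0)" by presburger+
    with Suc show ?case by (simp only: old.nat.simps prod_encode_inverse fst_conv snd_conv split: if_split) simp
  qed simp
  moreover have "total_computable D (\<lambda>Q n. rec_nat \<langle>0, 0\<rangle> (\<lambda>k. ?g) (f Q n))"
    by (intro tc_rec tc_if_zero tc_pair tc_Suc tc_fst tc_snd tc_id assms tc_const)
  ultimately show ?thesis by (simp only:)
qed

lemma tc_half:
  assumes "total_computable D f"
  shows "total_computable D (\<lambda>Q n. f Q n div 2)"
  using tc_fst[OF tc_divmod_two[OF assms]] by simp

lemma tc_if_even:
  assumes "total_computable D f" "total_computable D a" "total_computable D b"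
  shows "total_computable D (\<lambda>Q n. if even (f Q n) then a Q n else b Q n)"
  using tc_if_zero[OF tc_snd[OF tc_divmod_two[OF assms(1)]] assms(2,3)]
  by (simp add: even_iff_mod_2_eq_zero)

lemmas tc_intros = tc_id tc_const tc_Suc tc_fst tc_snd tc_pair tc_pred tc_add tc_half
  tc_if_eq tc_if_even tc_query

text \<open>Relative to \<open>Q\<close>, an oracle that is itself computable from \<open>Q\<close> is eliminated by
  substituting its program for the queries.\<close>

primrec subst_query :: "prog \<Rightarrow> prog \<Rightarrow> prog" where
  "subst_query h PZero = PZero"
| "subst_query h PSucc = PSucc"
| "subst_query h PFst = PFst"
| "subst_query h PSnd = PSnd"
| "subst_query h PQuery = h"
| "subst_query h (PPair f g) = PPair (subst_query h f) (subst_query h g)"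
| "subst_query h (PComp f g) = PComp (subst_query h f) (subst_query h g)"
| "subst_query h (PPrec f g) = PPrec (subst_query h f) (subst_query h g)"
| "subst_query h (PMu f) = PMu (subst_query h f)"

lemma eval_subst_query:
  assumes "eval Q h = (\<lambda>n. Some (q n))"
  shows "eval Q (subst_query h e) = eval q e"
  by (induction e) (simp_all add: assms)

lemma tc_eval:
  assumes "total_computable D f"
    and "\<And>Q n. Q \<in> D \<Longrightarrow> eval (f Q) e n \<noteq> None"
  shows "total_computable D (\<lambda>Q n. the (eval (f Q) e n))"
proof -
  obtain h where h: "\<forall>Q\<in>D. \<forall>n. eval Q h n = Some (f Q n)"
    using assms unfolding total_computable_def by blast
  show ?thesis
  proof (rule total_computableI[where e = "subst_query h e"])
    fix Q n assume "Q \<in> D"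
    with h have "eval Q h = (\<lambda>n. Some (f Q n))" by blast
    from eval_subst_query[OF this] assms(2)[OF \<open>Q \<in> D\<close>]
    show "eval Q (subst_query h e) n = Some (the (eval (f Q) e n))" by simp
  qed
qed

section \<open>A universal stack machine\<close>

text \<open>
  Oracle answers are coded with \<open>0\<close> for ``not available'' and \<open>Suc v\<close> for the answer \<open>v\<close>, so that
  the machine can be run on approximations of a partial oracle; a missing answer makes it loop.
  A continuation is a nested pair \<open>\<langle>tag, \<langle>data, rest\<rangle>\<rangle>\<close>; tag \<open>0\<close> is the empty stack, and
  \<open>0 = \<langle>0, 0\<rangle>\<close> is such a continuation.
\<close>

definition ev :: "nat \<Rightarrow> nat \<Rightarrow> nat \<Rightarrow> nat" where
  "ev c n K = \<langle>0, \<langle>c, \<langle>n, K\<rangle>\<rangle>\<rangle>"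

definition ret :: "nat \<Rightarrow> nat \<Rightarrow> nat" where
  "ret v K = \<langle>1, \<langle>v, K\<rangle>\<rangle>"

definition frame :: "nat \<Rightarrow> nat \<Rightarrow> nat \<Rightarrow> nat" where
  "frame t d K = \<langle>t, \<langle>d, K\<rangle>\<rangle>"

text \<open>The tests on \<open>t\<close> follow the tags of \<open>prog_code\<close>. An unknown
  tag leaves the state fixed, so the evaluation never halts.\<close>

definition ev_step :: "(nat \<Rightarrow> nat) \<Rightarrow> nat \<Rightarrow> nat" where
  "ev_step h s = (
     let c = pfst (psnd s); n = pfst (psnd (psnd s)); K = psnd (psnd (psnd s)); t = pfst c; b = psnd c
     in if t = 0 then ret 0 K
     else if t = 1 then ret (Suc n) K
     else if t = 2 then ret (pfst n) K
     else if t = 3 then ret (psnd n) K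
     else if t = 4 then (if h n = 0 then s else ret (h n - 1) K)
     else if t = 5 then ev (pfst b) n (frame 1 \<langle>psnd b, n\<rangle> K)
     else if t = 6 then ev (psnd b) n (frame 3 (pfst b) K)
     else if t = 7 then ev (pfst b) (pfst n) (frame 4 \<langle>psnd b, \<langle>pfst n, \<langle>0, psnd n\<rangle>\<rangle>\<rangle> K)
     else if t = 8 then ev b \<langle>n, 0\<rangle> (frame 5 \<langle>b, \<langle>n, 0\<rangle>\<rangle> K)
     else s)"

text \<open>Frames by tag: 1 keeps the second program of a pair and its argument, 2 the finished
  first value, 3 the outer program of a composition, 4 the step program, parameter, counter and
  remaining rounds of a recursion, 5 a search with its current candidate.\<close>

definition ret_step :: "nat \<Rightarrow> nat" where
  "ret_step s = (
     let v = pfst (psnd s); t = pfst (psnd (psnd s));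
         d = pfst (psnd (psnd (psnd s))); K = psnd (psnd (psnd (psnd s)))
     in if t = 1 then ev (pfst d) (psnd d) (frame 2 v K)
     else if t = 2 then ret \<langle>d, v\<rangle> K
     else if t = 3 then ev d v K
     else if t = 4 then
       (let g = pfst d; x = pfst (psnd d); k = pfst (psnd (psnd d)); m = psnd (psnd (psnd d))
        in if m = 0 then ret v K
           else ev g \<langle>x, \<langle>k, v\<rangle>\<rangle> (frame 4 \<langle>g, \<langle>x, \<langle>Suc k, m - 1\<rangle>\<rangle>\<rangle> K))
     else if t = 5 then
       (let f = pfst d; n = pfst (psnd d); k = psnd (psnd d)
        in if v = 0 then ret k K else ev f \<langle>n, Suc k\<rangle> (frame 5 \<langle>f, \<langle>n, Suc k\<rangle>\<rangle> K))
     else s)"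

definition step :: "(nat \<Rightarrow> nat) \<Rightarrow> nat \<Rightarrow> nat" where
  "step h s = (if pfst s = 0 then ev_step h s else ret_step s)"

definition halted :: "nat \<Rightarrow> bool" where
  "halted s \<longleftrightarrow> pfst s \<noteq> 0 \<and> pfst (psnd (psnd s)) = 0"

text \<open>The value \<open>0\<close> means no result yet and \<open>Suc v\<close> the result
  \<open>v\<close>. This is the coding of oracle answers, so a bounded run can itself serve as an
  approximate oracle.\<close>

definition run :: "(nat \<Rightarrow> nat) \<Rightarrow> nat \<Rightarrow> nat \<Rightarrow> nat \<Rightarrow> nat" where
  "run h c n t = (let s = (step h ^^ t) (ev c n 0) in if halted s then Suc (pfst (psnd s)) else 0)"

text \<open>The simulated oracle \<open>h Q n\<close> may depend on the input \<open>n\<close>,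
  hence the assumption treats input and query as one pair.\<close>

lemma tc_step:
  assumes "total_computable D (\<lambda>Q z. h Q (pfst z) (psnd z))" "total_computable D s"
  shows "total_computable D (\<lambda>Q n. step (h Q n) (s Q n))"
proof -
  have h: "total_computable D (\<lambda>Q n. h Q n (f Q n))" if "total_computable D f" for f
    using tc_comp[OF assms(1) tc_pair[OF tc_id that]] by simp
  show ?thesis
    unfolding step_def ev_step_def ret_step_def Let_def ev_def ret_def frame_def
    by (intro tc_intros h assms(2))
qed

lemma tc_run:
  assumes "total_computable D (\<lambda>Q z. h Q (pfst z) (psnd z))"
    and "total_computable D c" "total_computable D x" "total_computable D t"
  shows "total_computable D (\<lambda>Q n. run (h Q n) (c Q n) (x Q n) (t Q n))"
proof -
  have rec: "(f ^^ t) s = rec_nat s (\<lambda>k. f) t" for f :: "nat \<Rightarrow> nat" and t s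
    by (induction t) simp_all
  have h: "total_computable D (\<lambda>Q z. h Q (pfst (pfst z)) (psnd z))"
    using tc_comp[OF assms(1) tc_pair[OF tc_fst[OF tc_fst[OF tc_id]] tc_snd[OF tc_id]]] by simp
  have s: "total_computable D (\<lambda>Q n. (step (h Q n) ^^ t Q n) (ev (c Q n) (x Q n) 0))"
    unfolding rec ev_def
    by (intro tc_rec tc_pair tc_const assms(2-4) tc_step[where h = "\<lambda>Q z. h Q (pfst z)"] h
        tc_snd tc_id)
  have "(if halted s then Suc (pfst (psnd s)) else 0) =
    (if pfst s = 0 then 0 else if pfst (psnd (psnd s)) = 0 then Suc (pfst (psnd s)) else 0)" for s
    by (simp add: halted_def)
  then show ?thesis
    unfolding run_def Let_def by (simp only:) (intro tc_intros s)
qed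

section \<open>Transitions and halting of the machine\<close>

lemma step_ev [simp]:
  "step h (ev \<langle>0, b\<rangle> n K) = ret 0 K"
  "step h (ev \<langle>Suc 0, b\<rangle> n K) = ret (Suc n) K"
  "step h (ev \<langle>2, b\<rangle> n K) = ret (pfst n) K"
  "step h (ev \<langle>3, b\<rangle> n K) = ret (psnd n) K"
  "step h (ev \<langle>4, b\<rangle> n K) = (if h n = 0 then ev \<langle>4, b\<rangle> n K else ret (h n - 1) K)"
  "step h (ev \<langle>5, \<langle>c, d\<rangle>\<rangle> n K) = ev c n (frame 1 \<langle>d, n\<rangle> K)"
  "step h (ev \<langle>6, \<langle>c, d\<rangle>\<rangle> n K) = ev d n (frame 3 c K)"
  "step h (ev \<langle>7, \<langle>c, d\<rangle>\<rangle> \<langle>n, m\<rangle> K) = ev c n (frame 4 \<langle>d, \<langle>n, \<langle>0, m\<rangle>\<rangle>\<rangle> K)"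
  "step h (ev \<langle>8, c\<rangle> n K) = ev c \<langle>n, 0\<rangle> (frame 5 \<langle>c, \<langle>n, 0\<rangle>\<rangle> K)"
  by (simp_all add: step_def ev_step_def ev_def)

lemma step_ret [simp]:
  "step h (ret v (frame (Suc 0) \<langle>d, n\<rangle> K)) = ev d n (frame 2 v K)"
  "step h (ret v (frame 2 a K)) = ret \<langle>a, v\<rangle> K"
  "step h (ret v (frame 3 c K)) = ev c v K"
  "step h (ret v (frame 4 \<langle>d, \<langle>n, \<langle>k, 0\<rangle>\<rangle>\<rangle> K)) = ret v K"
  "step h (ret v (frame 4 \<langle>d, \<langle>n, \<langle>k, Suc m\<rangle>\<rangle>\<rangle> K)) =
     ev d \<langle>n, \<langle>k, v\<rangle>\<rangle> (frame 4 \<langle>d, \<langle>n, \<langle>Suc k, m\<rangle>\<rangle>\<rangle> K)"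
  "step h (ret 0 (frame 5 \<langle>c, \<langle>n, k\<rangle>\<rangle> K)) = ret k K"
  "step h (ret (Suc v) (frame 5 \<langle>c, \<langle>n, k\<rangle>\<rangle> K)) = ev c \<langle>n, Suc k\<rangle> (frame 5 \<langle>c, \<langle>n, Suc k\<rangle>\<rangle> K)"
  by (simp_all add: step_def ret_step_def ret_def frame_def)

lemma not_halted_ev [simp]: "\<not> halted (ev c n K)"
  by (simp add: halted_def ev_def)

lemma halted_ret_0 [simp]: "halted (ret v 0)"
proof -
  have "prod_decode 0 = (0, 0)" using prod_encode_inverse[of "(0, 0)"] by (simp add: prod_encode_def)
  then show ?thesis by (simp add: halted_def ret_def)
qed

lemma step_halted: "halted s \<Longrightarrow> step h s = s"
  by (simp add: halted_def step_def ret_step_def)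

lemma funpow_fixpoint: "f s = s \<Longrightarrow> (f ^^ t) s = s"
  by (induction t) simp_all

lemma steps_halted_mono:
  assumes "halted ((step h ^^ t) s)" "t \<le> t'"
  shows "(step h ^^ t') s = (step h ^^ t) s"
proof -
  have "(step h ^^ t') s = (step h ^^ (t' - t)) ((step h ^^ t) s)"
    using assms(2) by (metis comp_apply funpow_add le_add_diff_inverse2)
  with funpow_fixpoint[of "step h"] step_halted[OF assms(1)] show ?thesis by simp
qed

lemma run_mono_time: "run h c n t = Suc v \<Longrightarrow> t \<le> t' \<Longrightarrow> run h c n t' = Suc v"
  using steps_halted_mono[of t h "ev c n 0" t'] by (simp add: run_def Let_def split: if_splits)

subsection \<open>Dependence on the oracle\<close>

text \<open>A step consults the oracle at one position at most, the argument field of the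
  state.\<close>

lemma step_cong: "h (pfst (psnd (psnd s))) = h' (pfst (psnd (psnd s))) \<Longrightarrow> step h s = step h' s"
  by (simp add: step_def ev_step_def Let_def)

lemma steps_continuous: "\<exists>m. \<forall>h'. (\<forall>i<m. h' i = h i) \<longrightarrow> (step h' ^^ t) s = (step h ^^ t) s"
proof (induction t)
  case (Suc t)
  then obtain m where m: "\<And>h'. \<forall>i<m. h' i = h i \<Longrightarrow> (step h' ^^ t) s = (step h ^^ t) s" by blast
  let ?i = "pfst (psnd (psnd ((step h ^^ t) s)))"
  have "(step h' ^^ Suc t) s = (step h ^^ Suc t) s" if "\<forall>i<max m (Suc ?i). h' i = h i" for h'
    using m[of h'] that step_cong[of h' "(step h ^^ t) s" h] by simp
  then show ?case by blast
qed simp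

lemma run_continuous:
  obtains m where "\<And>h'. \<forall>i<m. h' i = h i \<Longrightarrow> run h' c n t = run h c n t"
proof -
  obtain m where m: "\<forall>h'. (\<forall>i<m. h' i = h i) \<longrightarrow> (step h' ^^ t) (ev c n 0) = (step h ^^ t) (ev c n 0)"
    using steps_continuous by blast
  have "run h' c n t = run h c n t" if "\<forall>i<m. h' i = h i" for h'
    using m[rule_format, of h'] that unfolding run_def by metis
  then show thesis by (rule that)
qed

text \<open>A more informative oracle changes a step only at a query that \<open>h\<close> leaves
  unanswered, and there the machine under \<open>h\<close> waits.\<close>

lemma step_mono_or_stuck:
  assumes "\<And>i. h i \<noteq> 0 \<Longrightarrow> h' i = h i"
  shows "step h' s = step h s \<or> step h s = s"
proof (cases "h (pfst (psnd (psnd s))) = 0")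
  case True
  show ?thesis
  proof (cases "pfst s = 0 \<and> pfst (pfst (psnd s)) = 4")
    case True
    with \<open>h _ = 0\<close> have "step h s = s" by (simp add: step_def ev_step_def Let_def)
    then show ?thesis ..
  next
    case False
    then have "step h' s = step h s" by (auto simp: step_def ev_step_def Let_def)
    then show ?thesis ..
  qed
next
  case False
  then have "step h' s = step h s" by (intro step_cong assms)
  then show ?thesis ..
qed

lemma steps_mono_oracle:
  assumes "\<And>i. h i \<noteq> 0 \<Longrightarrow> h' i = h i"
  shows "halted ((step h ^^ t) s) \<Longrightarrow> (step h' ^^ t) s = (step h ^^ t) s"
proof (induction t arbitrary: s)
  case (Suc t)
  show ?case
  proof (cases "step h' s = step h s")
    case True
    with Suc show ?thesis by (simp add: funpow_Suc_right del: funpow.simps)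
  next
    case False
    \<comment> \<open>A state fixed under \<open>h\<close> from which a halted one is reached is
      halted already, hence fixed under \<open>h'\<close> too, contradicting the case.\<close>
    with step_mono_or_stuck[of h h' s] assms have stuck: "step h s = s" by blast
    from Suc.prems funpow_fixpoint[of "step h" s, OF stuck] have "halted s" by (simp add: stuck)
    from step_halted[OF this] stuck False show ?thesis by simp
  qed
qed simp

lemma run_mono_oracle:
  assumes "\<And>i. h i \<noteq> 0 \<Longrightarrow> h' i = h i" "run h c n t = Suc v"
  shows "run h' c n t = Suc v"
proof -
  have halted: "halted ((step h ^^ t) (ev c n 0))"
    using assms(2) by (simp add: run_def Let_def split: if_splits)
  have "(step h' ^^ t) (ev c n 0) = (step h ^^ t) (ev c n 0)"
    by (rule steps_mono_oracle[OF assms(1) halted])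
  with assms(2) show ?thesis by (simp add: run_def)
qed

subsection \<open>Correctness\<close>

text \<open>Turns \<open>LEAST\<close> into the run of the search: a positive test value is what
  makes frame 5 continue.\<close>

lemma eval_PMu_eq_Some_iff:
  "eval q (PMu f) n = Some k \<longleftrightarrow>
     eval q f \<langle>n, k\<rangle> = Some 0 \<and> (\<forall>j<k. \<exists>v. eval q f \<langle>n, j\<rangle> = Some (Suc v))"
proof -
  let ?halt = "\<lambda>k. eval q f \<langle>n, k\<rangle> = Some 0 \<and> (\<forall>j<k. eval q f \<langle>n, j\<rangle> \<noteq> None)"
  have uniq: "(LEAST k. ?halt k) = k" if "?halt k" "\<forall>j<k. eval q f \<langle>n, j\<rangle> \<noteq> Some 0" for k
    using that by (intro Least_equality) (auto simp: not_less[symmetric])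
  show ?thesis
  proof
    assume *: "eval q (PMu f) n = Some k"
    then have ex: "\<exists>k. ?halt k" by (auto simp: Let_def split: if_splits)
    with * have k: "k = (LEAST k. ?halt k)" by (simp add: Let_def)
    from LeastI_ex[OF ex] have hk: "?halt k" unfolding k .
    have "\<exists>v. eval q f \<langle>n, j\<rangle> = Some (Suc v)" if "j < k" for j
    proof -
      from not_less_Least[of j ?halt] that have "\<not> ?halt j" unfolding k .
      with hk that have "eval q f \<langle>n, j\<rangle> \<noteq> Some 0" "eval q f \<langle>n, j\<rangle> \<noteq> None" by auto
      then show ?thesis by (metis not0_implies_Suc option.exhaust)
    qed
    with hk show "eval q f \<langle>n, k\<rangle> = Some 0 \<and> (\<forall>j<k. \<exists>v. eval q f \<langle>n, j\<rangle> = Some (Suc v))" by blast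
  next
    assume "eval q f \<langle>n, k\<rangle> = Some 0 \<and> (\<forall>j<k. \<exists>v. eval q f \<langle>n, j\<rangle> = Some (Suc v))"
    then have "?halt k" "\<forall>j<k. eval q f \<langle>n, j\<rangle> \<noteq> Some 0" by fastforce+
    with uniq[of k] show "eval q (PMu f) n = Some k" by (auto simp: Let_def)
  qed
qed

definition reach :: "(nat \<Rightarrow> nat) \<Rightarrow> nat \<Rightarrow> nat \<Rightarrow> bool" where
  "reach h s s' \<longleftrightarrow> (\<exists>t. (step h ^^ t) s = s')"

lemma reach_refl: "reach h s s"
  unfolding reach_def by (rule exI[of _ 0]) simp

lemma reach_trans: "reach h s s' \<Longrightarrow> reach h s' s'' \<Longrightarrow> reach h s s''"
proof -
  assume "reach h s s'" "reach h s' s''"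
  then obtain t t' where "(step h ^^ t) s = s'" "(step h ^^ t') s' = s''"
    unfolding reach_def by blast
  then have "(step h ^^ (t' + t)) s = s''" by (simp add: funpow_add)
  then show ?thesis unfolding reach_def ..
qed

lemma reach_step: "reach h s s' \<Longrightarrow> reach h s (step h s')"
proof -
  assume "reach h s s'"
  then obtain t where "(step h ^^ t) s = s'" unfolding reach_def by blast
  then have "(step h ^^ Suc t) s = step h s'" by simp
  then show ?thesis unfolding reach_def ..
qed

lemma step_reach: "reach h (step h s) s' \<Longrightarrow> reach h s s'"
  by (rule reach_trans[OF reach_step[OF reach_refl]])

definition halts :: "(nat \<Rightarrow> nat) \<Rightarrow> nat \<Rightarrow> bool" where
  "halts h s \<longleftrightarrow> (\<exists>t. halted ((step h ^^ t) s))"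

lemma halts_reach:
  assumes "halts h s" "reach h s s'"
  shows "halts h s'"
proof -
  obtain t t' where t: "halted ((step h ^^ t) s)" "(step h ^^ t') s = s'"
    using assms unfolding halts_def reach_def by blast
  have "halted ((step h ^^ (t + t')) s)" using steps_halted_mono[OF t(1), of "t + t'"] t(1) by simp
  then have "halted ((step h ^^ t) s')" unfolding t(2)[symmetric] by (simp add: funpow_add)
  then show ?thesis unfolding halts_def by blast
qed

lemma halts_step: "halts h s \<Longrightarrow> halts h (step h s)"
  using halts_reach reach_step[OF reach_refl] by blast

text \<open>Completeness of the machine. \<open>K\<close> is arbitrary because the induction
  hypotheses are applied with the pushed frame as part of the continuation.\<close>

lemma eval_reach:
  fixes q :: baire
  defines "h \<equiv> \<lambda>i. Suc (q i)"
  shows "eval q e n = Some v \<Longrightarrow> reach h (ev (prog_code e) n K) (ret v K)"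
proof (induction e arbitrary: n v K)
  case (PPair f g)
  then obtain a b where ab: "eval q f n = Some a" "eval q g n = Some b" "v = \<langle>a, b\<rangle>"
    by (auto simp: bind_eq_Some_conv)
  have "reach h (ev (prog_code f) n (frame 1 \<langle>prog_code g, n\<rangle> K)) (ev (prog_code g) n (frame 2 a K))"
    using reach_step[OF PPair.IH(1)[OF ab(1)]] by (metis One_nat_def step_ret(1))
  from reach_step[OF reach_trans[OF this PPair.IH(2)[OF ab(2)]]] show ?case
    by - (rule step_reach, simp add: ab(3))
next
  case (PComp f g)
  then obtain a where a: "eval q g n = Some a" "eval q f a = Some v"
    by (auto simp: bind_eq_Some_conv)
  have "reach h (ev (prog_code g) n (frame 3 (prog_code f) K)) (ev (prog_code f) a K)"
    using reach_step[OF PComp.IH(2)[OF a(1)]] by (metis step_ret(3))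
  from reach_trans[OF this PComp.IH(1)[OF a(2)]] show ?case
    by - (rule step_reach, simp)
next
  case (PPrec f g)
  obtain x m where n: "n = \<langle>x, m\<rangle>" by (rule that[of "pfst n" "psnd n"]) simp
  let ?r = "rec_nat (eval q f x) (\<lambda>k r. Option.bind r (\<lambda>v. eval q g \<langle>x, \<langle>k, v\<rangle>\<rangle>))"
  \<comment> \<open>Loop invariant: after \<open>j\<close> of \<open>j + i\<close> rounds the frame
    shows counter \<open>j\<close> and \<open>i\<close> rounds left.\<close>
  have loop: "reach h (ev (prog_code f) x (frame 4 \<langle>prog_code g, \<langle>x, \<langle>0, j + i\<rangle>\<rangle>\<rangle> K))
    (ret w (frame 4 \<langle>prog_code g, \<langle>x, \<langle>j, i\<rangle>\<rangle>\<rangle> K))" if "?r j = Some w" for i j w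
    using that
  proof (induction j arbitrary: i w)
    case 0
    then show ?case using PPrec.IH(1) by simp
  next
    case (Suc j)
    then obtain u where u: "?r j = Some u" "eval q g \<langle>x, \<langle>j, u\<rangle>\<rangle> = Some w"
      by (auto simp: bind_eq_Some_conv)
    from reach_step[OF Suc.IH[OF u(1), of "Suc i"]]
    have "reach h (ev (prog_code f) x (frame 4 \<langle>prog_code g, \<langle>x, \<langle>0, Suc j + i\<rangle>\<rangle>\<rangle> K))
      (ev (prog_code g) \<langle>x, \<langle>j, u\<rangle>\<rangle> (frame 4 \<langle>prog_code g, \<langle>x, \<langle>Suc j, i\<rangle>\<rangle>\<rangle> K))" by simp
    from reach_trans[OF this PPrec.IH(2)[OF u(2)]] show ?case .
  qed
  from PPrec.prems have "?r m = Some v" by (simp add: n)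
  from reach_step[OF loop[OF this, of 0]] show ?case
    by - (rule step_reach, simp add: n)
next
  case (PMu f)
  then have k: "eval q f \<langle>n, v\<rangle> = Some 0" "\<And>j. j < v \<Longrightarrow> \<exists>v. eval q f \<langle>n, j\<rangle> = Some (Suc v)"
    using eval_PMu_eq_Some_iff by blast+
  let ?c = "prog_code f"
  let ?s = "\<lambda>j. ev ?c \<langle>n, j\<rangle> (frame 5 \<langle>?c, \<langle>n, j\<rangle>\<rangle> K)"
  have "reach h (?s 0) (?s j)" if "j \<le> v" for j
    using that
  proof (induction j)
    case 0
    show ?case by (rule reach_refl)
  next
    case (Suc j)
    then obtain u where "eval q f \<langle>n, j\<rangle> = Some (Suc u)" using k(2) by (meson Suc_le_lessD)
    from reach_step[OF PMu.IH[OF this]] have "reach h (?s j) (?s (Suc j))" by (metis step_ret(7))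
    with Suc show ?case by (auto intro: reach_trans)
  qed
  from reach_step[OF reach_trans[OF this[OF order_refl] PMu.IH[OF k(1)]]]
  show ?case by - (rule step_reach, simp)
qed (rule step_reach, simp add: h_def reach_refl)+

text \<open>By determinism a halting run passes through the return state of each subprogram already
  known to be defined, and it still halts from there; so the next subprogram is defined as
  well.\<close>

lemma halts_eval:
  fixes q :: baire
  defines "h \<equiv> \<lambda>i. Suc (q i)"
  shows "halts h (ev (prog_code e) n K) \<Longrightarrow> eval q e n \<noteq> None"
proof (induction e arbitrary: n K)
  case (PPair f g)
  from halts_step[OF PPair.prems] have *: "halts h (ev (prog_code f) n (frame 1 \<langle>prog_code g, n\<rangle> K))"
    by simp
  then obtain a where a: "eval q f n = Some a" using PPair.IH(1) by blast
  from halts_step[OF halts_reach[OF * eval_reach[OF a, folded h_def]]]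
  have "eval q g n \<noteq> None" using PPair.IH(2) by simp
  with a show ?case by auto
next
  case (PComp f g)
  from halts_step[OF PComp.prems] have *: "halts h (ev (prog_code g) n (frame 3 (prog_code f) K))"
    by simp
  then obtain a where a: "eval q g n = Some a" using PComp.IH(2) by blast
  from halts_step[OF halts_reach[OF * eval_reach[OF a, folded h_def]]]
  have "eval q f a \<noteq> None" using PComp.IH(1) by simp
  with a show ?case by auto
next
  case (PPrec f g)
  obtain x m where n: "n = \<langle>x, m\<rangle>" by (rule that[of "pfst n" "psnd n"]) simp
  let ?r = "rec_nat (eval q f x) (\<lambda>k r. Option.bind r (\<lambda>v. eval q g \<langle>x, \<langle>k, v\<rangle>\<rangle>))"
  let ?F = "\<lambda>j i. frame 4 \<langle>prog_code g, \<langle>x, \<langle>j, i\<rangle>\<rangle>\<rangle> K"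
  from halts_step[OF PPrec.prems] have *: "halts h (ev (prog_code f) x (?F 0 m))"
    by (simp add: n)
  have "\<exists>w. ?r j = Some w \<and> halts h (ret w (?F j i))" if "m = j + i" for i j
    using that
  proof (induction j arbitrary: i)
    case 0
    obtain a where a: "eval q f x = Some a" using PPrec.IH(1) * by blast
    from halts_reach[OF * eval_reach[OF a, folded h_def]] a 0 show ?case by simp
  next
    case (Suc j)
    then obtain w where w: "?r j = Some w" "halts h (ret w (?F j (Suc i)))"
      using Suc.IH[of "Suc i"] by auto
    from halts_step[OF w(2)] have *: "halts h (ev (prog_code g) \<langle>x, \<langle>j, w\<rangle>\<rangle> (?F (Suc j) i))" by simp
    then obtain a where a: "eval q g \<langle>x, \<langle>j, w\<rangle>\<rangle> = Some a" using PPrec.IH(2) by blast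
    from halts_reach[OF * eval_reach[OF a, folded h_def]] a w(1) show ?case by simp
  qed
  from this[of m 0] show ?case by (auto simp: n)
next
  case (PMu f)
  let ?c = "prog_code f"
  let ?s = "\<lambda>j. ev ?c \<langle>n, j\<rangle> (frame 5 \<langle>?c, \<langle>n, j\<rangle>\<rangle> K)"
  show ?case
  proof
    assume None: "eval q (PMu f) n = None"
    have halts: "halts h (?s 0)" using halts_step[OF PMu.prems] by simp
    \<comment> \<open>A diverging search would reach candidate \<open>j\<close> at a time no earlier
      than \<open>j\<close>, so unhalted states would occur arbitrarily late.\<close>
    have "(\<forall>i<j. \<exists>v. eval q f \<langle>n, i\<rangle> = Some (Suc v)) \<and> (\<exists>t\<ge>j. (step h ^^ t) (?s 0) = ?s j)" for j
    proof (induction j)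
      case 0
      show ?case by (auto intro: exI[of _ 0])
    next
      case (Suc j)
      then obtain t where t: "t \<ge> j" "(step h ^^ t) (?s 0) = ?s j" by blast
      have "halts h (?s j)" using halts_reach[OF halts] t(2) unfolding reach_def by blast
      then obtain a where a: "eval q f \<langle>n, j\<rangle> = Some a" using PMu.IH by blast
      have "a \<noteq> 0"
      proof
        assume "a = 0"
        with a Suc have "eval q (PMu f) n = Some j" unfolding eval_PMu_eq_Some_iff by blast
        with None show False by simp
      qed
      then obtain b where b: "a = Suc b" using not0_implies_Suc by blast
      obtain t' where t': "(step h ^^ t') (?s j) = ret a (frame 5 \<langle>?c, \<langle>n, j\<rangle>\<rangle> K)"
        using eval_reach[OF a, folded h_def] unfolding reach_def by blast
      have "(step h ^^ Suc (t' + t)) (?s 0) = ?s (Suc j)"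
        by (simp add: funpow_add t t' b)
      moreover have "Suc (t' + t) \<ge> Suc j" using t(1) by simp
      moreover have "\<forall>i<Suc j. \<exists>v. eval q f \<langle>n, i\<rangle> = Some (Suc v)"
        using Suc a b by (auto simp: less_Suc_eq)
      ultimately show ?case by blast
    qed
    then have late: "\<exists>t\<ge>j. (step h ^^ t) (?s 0) = ?s j" for j by blast
    obtain t where t: "halted ((step h ^^ t) (?s 0))" using halts unfolding halts_def by blast
    obtain t' where t': "t' \<ge> t" "(step h ^^ t') (?s 0) = ?s t" using late by blast
    have "halted (?s t)" using steps_halted_mono[OF t t'(1)] t t'(2) by metis
    then show False by simp
  qed
qed simp_all

text \<open>A normal form: evaluation becomes an unbounded search over total stages, and divergence
  becomes the absence of a successful stage.\<close>

theorem eval_iff_run: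
  "eval q e n = Some v \<longleftrightarrow> (\<exists>t. run (\<lambda>i. Suc (q i)) (prog_code e) n t = Suc v)"
proof -
  let ?h = "\<lambda>i. Suc (q i)"
  have fwd: "\<exists>t. run ?h (prog_code e) n t = Suc v" if v: "eval q e n = Some v" for v
  proof -
    obtain t where "(step ?h ^^ t) (ev (prog_code e) n 0) = ret v 0"
      using eval_reach[OF v] unfolding reach_def by blast
    then have "run ?h (prog_code e) n t = Suc v" by (simp add: run_def) (simp add: ret_def)
    then show ?thesis ..
  qed
  moreover have "eval q e n = Some v" if "run ?h (prog_code e) n t = Suc v" for t
  proof -
    have "halts ?h (ev (prog_code e) n 0)"
      using that unfolding run_def Let_def halts_def by (auto split: if_splits)
    then obtain w where w: "eval q e n = Some w" using halts_eval by blast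
    then obtain t' where "run ?h (prog_code e) n t' = Suc w" using fwd by blast
    \<comment> \<open>Both results persist until the later of the two times.\<close>
    with that have "Suc v = Suc w"
      using run_mono_time[of ?h "prog_code e" n t v "max t t'"]
        run_mono_time[of ?h "prog_code e" n t' w "max t t'"] by simp
    with w show ?thesis by simp
  qed
  ultimately show ?thesis by blast
qed

lemma eval_continuous:
  assumes "eval q e n = Some v"
  obtains m where "\<And>q'. \<forall>i<m. q' i = q i \<Longrightarrow> eval q' e n = Some v"
proof -
  obtain t where t: "run (\<lambda>i. Suc (q i)) (prog_code e) n t = Suc v"
    using assms eval_iff_run by blast
  obtain m where m: "\<And>h'. \<forall>i<m. h' i = Suc (q i) \<Longrightarrow>
      run h' (prog_code e) n t = run (\<lambda>i. Suc (q i)) (prog_code e) n t"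
    using run_continuous[of "\<lambda>i. Suc (q i)" "prog_code e" n t] by metis
  have "eval q' e n = Some v" if "\<forall>i<m. q' i = q i" for q'
  proof -
    have "run (\<lambda>i. Suc (q' i)) (prog_code e) n t = Suc v" using m[of "\<lambda>i. Suc (q' i)"] that t by simp
    then show ?thesis using eval_iff_run by blast
  qed
  then show thesis by (rule that)
qed

section \<open>Names of open sets\<close>

lemma repr_restrict_eq_Some_iff: "repr_restrict \<rho> Y q = Some x \<longleftrightarrow> \<rho> q = Some x \<and> x \<in> Y"
  by (auto simp: repr_restrict_def restrict_map_def)

lemma ran_repr_restrict: "ran (repr_restrict \<rho> Y) = ran \<rho> \<inter> Y"
  by (auto simp: ran_def repr_restrict_eq_Some_iff)

lemma type2_eq_Some_iff: "type2 e p = Some y \<longleftrightarrow> (\<forall>k. eval p e k = Some (y k))"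
proof
  show "\<forall>k. eval p e k = Some (y k)" if "type2 e p = Some y"
    using that unfolding type2_def by (auto split: if_splits)
qed (simp add: type2_def)

lemma eta_case_nat: "eta (case_nat (prog_code e) s) q = type2 e (join s q)"
  by (simp add: eta_def inv_f_f[OF inj_prog_code])

lemma eta_eq_Some_iff:
  "eta p q = Some y \<longleftrightarrow> (\<exists>e. p 0 = prog_code e \<and> type2 e (join (\<lambda>n. p (Suc n)) q) = Some y)"
proof -
  have "inv prog_code (prog_code e) = e" for e
    by (simp add: inv_f_f[OF inj_prog_code])
  then show ?thesis unfolding eta_def by (auto simp: prog_code_eq_iff)
qed

lemma join_double [simp]: "join p q (2 * n) = p n" "join p q (Suc (2 * n)) = q n"
  by (simp_all add: join_def)

text \<open>Replaces characteristic maps by sets: the machine must be total on all names of points,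
  and a nonzero output symbol signals membership.\<close>

lemma open_repr_eq_Some_iff:
  "open_repr \<rho> p = Some U \<longleftrightarrow> U \<subseteq> ran \<rho> \<and>
     (\<forall>q x. \<rho> q = Some x \<longrightarrow> (\<exists>y. eta p q = Some y \<and> (y \<noteq> (\<lambda>_. 0) \<longleftrightarrow> x \<in> U)))"
  (is "?L \<longleftrightarrow> ?R")
proof
  assume ?L
  then obtain f where f: "fun_repr \<rho> sierpinski_repr p = Some f" "U = {x \<in> ran \<rho>. f x}"
    unfolding open_repr_def by auto
  have "\<exists>y. eta p q = Some y \<and> (y \<noteq> (\<lambda>_. 0) \<longleftrightarrow> x \<in> U)" if q: "\<rho> q = Some x" for q x
  proof -
    have "x \<in> ran \<rho>" using q by (auto simp: ran_def)
    moreover obtain y where "eta p q = Some y" "sierpinski_repr y = Some (f x)"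
      using f(1) q unfolding fun_repr_eq_Some_iff realizes_def by blast
    ultimately show ?thesis using f(2) by (auto simp: sierpinski_repr_def)
  qed
  with f(2) show ?R by blast
next
  assume R: ?R
  let ?f = "restrict (\<lambda>x. x \<in> U) (ran \<rho>)"
  have "realizes \<rho> sierpinski_repr (eta p) ?f"
    unfolding realizes_def
  proof (intro allI impI)
    fix q x assume "\<rho> q = Some x"
    with R obtain y where "eta p q = Some y" "y \<noteq> (\<lambda>_. 0) \<longleftrightarrow> x \<in> U" by blast
    moreover have "x \<in> ran \<rho>" using \<open>\<rho> q = Some x\<close> by (auto simp: ran_def)
    ultimately show "\<exists>y. eta p q = Some y \<and> sierpinski_repr y = Some (?f x)"
      by (auto simp: sierpinski_repr_def)
  qed
  then have "fun_repr \<rho> sierpinski_repr p = Some ?f"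
    unfolding fun_repr_eq_Some_iff by simp
  moreover have "{x \<in> ran \<rho>. ?f x} = U" using R by auto
  ultimately show ?L unfolding open_repr_def by simp
qed

text \<open>A sequence \<open>s\<close> enumerates \<open>{i. Suc i \<in> range s}\<close>; the value \<open>0\<close> is a blank.\<close>

lemma enumeration_program:
  "\<exists>e. \<forall>s q k. eval (join s q) e k = Some (if s k = Suc (q 0) then 1 else 0)"
proof -
  \<comment> \<open>In \<open>join s q\<close> the entry \<open>s k\<close> sits at position
    \<open>k + k\<close> and the tested number \<open>q 0\<close> at position 1.\<close>
  have "total_computable UNIV (\<lambda>Q k. if Q (k + k) = Suc (Q 1) then 1 else 0)"
    by (intro tc_intros)
  then obtain e where "\<forall>Q k. eval Q e k = Some (if Q (k + k) = Suc (Q 1) then 1 else 0)"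
    unfolding total_computable_def by blast
  then have "\<forall>s q k. eval (join s q) e k = Some (if s k = Suc (q 0) then 1 else 0)"
    by (simp add: join_def flip: mult_2)
  then show ?thesis ..
qed

definition enum_prog :: prog where
  "enum_prog = (SOME e. \<forall>s q k. eval (join s q) e k = Some (if s k = Suc (q 0) then 1 else 0))"

text \<open>One fixed machine code in front makes a name out of any sequence, so a prefix of
  \<open>s\<close> determines a prefix of the name.\<close>

definition enum_name :: "baire \<Rightarrow> baire" where
  "enum_name s = case_nat (prog_code enum_prog) s"

lemma eval_enum_prog: "eval (join s q) enum_prog k = Some (if s k = Suc (q 0) then 1 else 0)"
  unfolding enum_prog_def using someI_ex[OF enumeration_program] by simp

lemma enum_name_cong: "\<forall>i<m. s' i = s i \<Longrightarrow> i < m \<Longrightarrow> enum_name s' i = enum_name s i"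
  unfolding enum_name_def by (cases i) auto

lemma open_repr_enum_name: "open_repr nat_repr (enum_name s) = Some {i. Suc i \<in> range s}"
  unfolding open_repr_eq_Some_iff
proof (intro conjI allI impI)
  show "{i. Suc i \<in> range s} \<subseteq> ran nat_repr"
    by (auto simp: ran_def nat_repr_def intro: exI[of _ "\<lambda>_. i" for i])
  fix q i assume "nat_repr q = Some i"
  then have i: "i = q 0" by (simp add: nat_repr_def)
  let ?y = "\<lambda>k. if s k = Suc i then 1 else 0 :: nat"
  have "eta (enum_name s) q = Some ?y"
    unfolding enum_name_def eta_case_nat type2_eq_Some_iff by (simp add: eval_enum_prog i)
  moreover have "?y \<noteq> (\<lambda>_. 0) \<longleftrightarrow> i \<in> {i. Suc i \<in> range s}"
  proof -
    have "?y \<noteq> (\<lambda>_. 0) \<longleftrightarrow> (\<exists>k. s k = Suc i)" by (auto simp: fun_eq_iff)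
    then show ?thesis by (metis mem_Collect_eq rangeE rangeI)
  qed
  ultimately show "\<exists>y. eta (enum_name s) q = Some y \<and>
      (y \<noteq> (\<lambda>_. 0) \<longleftrightarrow> i \<in> {i. Suc i \<in> range s})" by blast
qed

text \<open>Past the prefix, every element of \<open>A\<close> gets a place of its own, with blanks
  elsewhere. Hence a finite prefix can be completed for every point compatible with it.\<close>

lemma extend_enumeration:
  fixes s :: baire
  assumes "\<forall>j<m. \<forall>i. s j = Suc i \<longrightarrow> i \<in> A"
  shows "\<exists>s'. (\<forall>i<m. s' i = s i) \<and> {i. Suc i \<in> range s'} = A"
proof -
  define s' where "s' = (\<lambda>i. if i < m then s i else if i - m \<in> A then Suc (i - m) else 0)"
  have "i \<in> A" if "Suc i = s' j" for i j
    using that assms by (auto simp: s'_def split: if_splits)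
  moreover have "Suc i \<in> range s'" if "i \<in> A" for i
    using that by (intro range_eqI[of _ _ "m + i"]) (simp add: s'_def)
  ultimately have "{i. Suc i \<in> range s'} = A" by blast
  moreover have "\<forall>i<m. s' i = s i" by (simp add: s'_def)
  ultimately show ?thesis by blast
qed

lemma ex_enumeration: "\<exists>s :: baire. {i. Suc i \<in> range s} = A"
  using extend_enumeration[of 0 "\<lambda>_. 0" A] by auto

section \<open>Finite use\<close>

lemma uniform_prefix:
  fixes s :: baire
  assumes "\<And>n. n < N \<Longrightarrow> \<exists>m. \<forall>s'. (\<forall>i<m. s' i = s i) \<longrightarrow> P n s'"
  shows "\<exists>m. \<forall>s'. (\<forall>i<m. s' i = s i) \<longrightarrow> (\<forall>n<N::nat. P n s')"
  using assms
proof (induction N)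
  case (Suc N)
  then obtain m m' where "\<And>s'. \<forall>i<m. s' i = s i \<Longrightarrow> \<forall>n<N. P n s'"
    "\<And>s'. \<forall>i<m'. s' i = s i \<Longrightarrow> P N s'"
    by (metis less_Suc_eq)
  then have "\<forall>s'. (\<forall>i<max m m'. s' i = s i) \<longrightarrow> (\<forall>n<Suc N. P n s')"
    by (simp add: less_Suc_eq)
  then show ?case by blast
qed simp

lemma type2_continuous:
  assumes "type2 e p = Some y"
  obtains m where "\<And>p' y'. \<forall>i<m. p' i = p i \<Longrightarrow> type2 e p' = Some y' \<Longrightarrow> \<forall>i<N. y' i = y i"
proof -
  have "\<exists>m. \<forall>p'. (\<forall>i<m. p' i = p i) \<longrightarrow> eval p' e n = Some (y n)" for n
  proof -
    have "eval p e n = Some (y n)" using assms type2_eq_Some_iff by blast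
    then obtain m where "\<And>p'. \<forall>i<m. p' i = p i \<Longrightarrow> eval p' e n = Some (y n)"
      using eval_continuous[of p e n "y n"] by metis
    then show ?thesis by blast
  qed
  then obtain m where m: "\<forall>p'. (\<forall>i<m. p' i = p i) \<longrightarrow> (\<forall>n<N. eval p' e n = Some (y n))"
    using uniform_prefix[of N p "\<lambda>n p'. eval p' e n = Some (y n)"] by blast
  have "\<forall>i<N. y' i = y i" if "\<forall>i<m. p' i = p i" "type2 e p' = Some y'" for p' y'
    using m that unfolding type2_eq_Some_iff by (metis option.inject)
  then show thesis by (rule that)
qed

text \<open>A basic open set of the product constrains finitely many coordinates.\<close>

lemma open_baire_prefix:
  fixes S :: "baire set"
  assumes "open S" "y \<in> S"
  obtains m where "\<And>y'. \<forall>i<m. y' i = y i \<Longrightarrow> y' \<in> S"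
proof -
  have "openin (product_topology (\<lambda>i. euclidean) UNIV) S"
    using assms(1) by (simp add: open_fun_def)
  from product_topology_open_contains_basis[OF this assms(2)]
  obtain Z where Z: "y \<in> Pi\<^sub>E UNIV Z" "finite {i. Z i \<noteq> UNIV}" "Pi\<^sub>E UNIV Z \<subseteq> S" by auto
  obtain m where m: "\<And>i. Z i \<noteq> UNIV \<Longrightarrow> i < m"
    using Z(2) finite_nat_set_iff_bounded by auto
  have "y' \<in> S" if "\<forall>i<m. y' i = y i" for y'
  proof -
    have "y' i \<in> Z i" for i
    proof (cases "Z i = UNIV")
      case False
      then have "y' i = y i" using m that by blast
      with Z(1) show ?thesis by auto
    qed simp
    with Z(3) show ?thesis by auto
  qed
  then show thesis by (rule that)
qed

section \<open>Subspaces\<close>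

locale subbase_space =
  fixes X :: "'a set" and \<rho> :: "'a repr" and B :: "nat \<Rightarrow> 'a set" and e1 e2 :: prog
  assumes ran: "ran \<rho> = X"
    and inj: "inj_on (\<lambda>x. {i. x \<in> B i}) X"
    and e1: "realizes \<rho> (subbase_repr X B) (type2 e1) (\<lambda>x. x)"
    and e2: "realizes (subbase_repr X B) \<rho> (type2 e2) (\<lambda>x. x)"
begin

abbreviation indices :: "'a \<Rightarrow> nat set" where
  "indices x \<equiv> {i. x \<in> B i}"

lemma point_of_enumeration:
  assumes "x \<in> X" "{i. Suc i \<in> range s} = indices x"
  obtains y where "type2 e2 (enum_name s) = Some y" "\<rho> y = Some x"
proof -
  have "subbase_repr X B (enum_name s) = Some x"
    using assms subbase_repr_eq_Some_iff[OF inj] open_repr_enum_name by simp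
  with e2 that show thesis unfolding realizes_def by blast
qed

text \<open>Continuity of \<open>e2\<close>: finitely many entries of an enumeration already force
  the computed name into the open set that cuts out the names of points of \<open>V\<close>.\<close>

lemma open_in_subspace_basic:
  assumes "openin (final_topology (repr_restrict \<rho> Y)) V" "x \<in> V"
  shows "\<exists>J. finite J \<and> J \<subseteq> indices x \<and> (\<forall>x'\<in>X \<inter> Y. J \<subseteq> indices x' \<longrightarrow> x' \<in> V)"
proof -
  let ?\<sigma> = "repr_restrict \<rho> Y"
  have "V \<subseteq> X \<inter> Y"
    using assms(1) ran unfolding openin_final_topology ran_repr_restrict by simp
  with assms(2) have x: "x \<in> X" "x \<in> Y" by auto
  obtain T where T: "open T" "{p. \<exists>x\<in>V. ?\<sigma> p = Some x} = dom ?\<sigma> \<inter> T"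
    using assms(1) unfolding openin_final_topology openin_open by blast
  obtain s :: baire where s: "{i. Suc i \<in> range s} = indices x"
    using ex_enumeration[of "indices x"] by blast
  obtain y where y: "type2 e2 (enum_name s) = Some y" "\<rho> y = Some x"
    using point_of_enumeration[OF x(1) s] .
  have "?\<sigma> y = Some x" using y(2) x(2) by (simp add: repr_restrict_eq_Some_iff)
  then have "y \<in> T" using T(2) assms(2) by blast
  then obtain N where N: "\<And>y'. \<forall>i<N. y' i = y i \<Longrightarrow> y' \<in> T"
    using open_baire_prefix[OF T(1)] by metis
  obtain m where m: "\<And>p' y'. \<forall>i<m. p' i = enum_name s i \<Longrightarrow> type2 e2 p' = Some y' \<Longrightarrow> \<forall>i<N. y' i = y i"
    using type2_continuous[OF y(1), where N = N] by metis
  \<comment> \<open>These are the indices among the first \<open>m\<close> entries, the prefix that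
    forces the computed name into \<open>T\<close>.\<close>
  define J where "J = {i. Suc i \<in> s ` {..<m}}"
  have "finite J"
    unfolding J_def using finite_vimageI[OF finite_imageI[OF finite_lessThan[of m]] inj_Suc, of s]
    by (simp add: vimage_def)
  moreover have "J \<subseteq> indices x" unfolding J_def using s by blast
  moreover have "x' \<in> V" if x': "x' \<in> X \<inter> Y" "J \<subseteq> indices x'" for x'
  proof -
    have "\<forall>j<m. \<forall>i. s j = Suc i \<longrightarrow> i \<in> J"
      unfolding J_def by (metis imageI lessThan_iff mem_Collect_eq)
    with x'(2) have "\<forall>j<m. \<forall>i. s j = Suc i \<longrightarrow> i \<in> indices x'" by blast
    from extend_enumeration[OF this]
    obtain s' where s': "\<forall>i<m. s' i = s i" "{i. Suc i \<in> range s'} = indices x'" by blast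
    obtain y' where y': "type2 e2 (enum_name s') = Some y'" "\<rho> y' = Some x'"
      using point_of_enumeration[OF _ s'(2)] x'(1) by blast
    have "\<forall>i<N. y' i = y i" using m[OF _ y'(1)] enum_name_cong[OF s'(1)] by blast
    then have "y' \<in> T" by (rule N)
    moreover have \<sigma>: "?\<sigma> y' = Some x'" using y'(2) x'(1) by (simp add: repr_restrict_eq_Some_iff)
    ultimately have "\<exists>x\<in>V. ?\<sigma> y' = Some x" using T(2) by blast
    with \<sigma> show ?thesis by auto
  qed
  ultimately show ?thesis by blast
qed

text \<open>One inclusion is the finite use of enumerations; the other holds because preimages of
  traces are traces of preimages.\<close>

lemma final_topology_subspace:
  assumes top: "final_topology \<rho> = topology_generated_by (range B)"
    and cover: "\<forall>x\<in>X. \<exists>i. x \<in> B i" and "Y \<subseteq> X"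
  shows "final_topology (repr_restrict \<rho> Y) = topology_generated_by (range (\<lambda>i. B i \<inter> Y))"
    (is "?F = ?G")
proof (rule topology_eq[THEN iffD2], intro allI iffI)
  fix V assume V: "openin ?F V"
  have VY: "V \<subseteq> Y"
    using V unfolding openin_final_topology ran_repr_restrict by simp
  show "openin ?G V"
  proof (subst openin_subopen, intro ballI)
    fix x assume x: "x \<in> V"
    obtain J where J: "finite J" "J \<subseteq> indices x" "\<forall>x'\<in>X \<inter> Y. J \<subseteq> indices x' \<longrightarrow> x' \<in> V"
      using open_in_subspace_basic[OF V x] by blast
    obtain i0 where i0: "x \<in> B i0" using cover x VY \<open>Y \<subseteq> X\<close> by blast
    \<comment> \<open>The index \<open>i0\<close> from the cover keeps the family nonempty even if
      \<open>J\<close> is empty.\<close>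
    let ?T = "\<Inter>i\<in>insert i0 J. B i \<inter> Y"
    have "openin ?G ?T"
      by (rule openin_INT2) (use J(1) in \<open>auto intro: topology_generated_by_Basis\<close>)
    moreover have "x \<in> ?T" using i0 J(2) x VY by auto
    moreover have "?T \<subseteq> V" using J(3) \<open>Y \<subseteq> X\<close> by auto
    ultimately show "\<exists>T. openin ?G T \<and> x \<in> T \<and> T \<subseteq> V" by blast
  qed
next
  let ?\<sigma> = "repr_restrict \<rho> Y"
  fix V assume "openin ?G V"
  then have "generate_topology_on (range (\<lambda>i. B i \<inter> Y)) V"
    by (simp add: openin_topology_generated_by_iff)
  then show "openin ?F V"
  proof induction
    case (Basis V)
    then obtain i where V: "V = B i \<inter> Y" by blast
    have "openin (final_topology \<rho>) (B i)"
      unfolding top by (rule topology_generated_by_Basis) simp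
    then obtain T where T: "B i \<subseteq> ran \<rho>" "open T" "{p. \<exists>x\<in>B i. \<rho> p = Some x} = dom \<rho> \<inter> T"
      unfolding openin_final_topology openin_open by blast
    have "{p. \<exists>x\<in>V. ?\<sigma> p = Some x} = dom ?\<sigma> \<inter> {p. \<exists>x\<in>B i. \<rho> p = Some x}"
      unfolding V by (auto simp: repr_restrict_eq_Some_iff dom_def)
    also have "\<dots> = dom ?\<sigma> \<inter> T"
      unfolding T(3) by (auto simp: repr_restrict_eq_Some_iff dom_def)
    finally show ?case
      unfolding openin_final_topology openin_open ran_repr_restrict using T V by blast
  qed auto
qed

subsection \<open>Extending open subsets of a subspace\<close>

text \<open>
  \<open>accept p A\<close>: the machine named by \<open>p\<close>, fed with the point computed from some sequence of
  elements of \<open>A\<close>, outputs a nonzero symbol. The sequence need not enumerate all of \<open>A\<close>, so the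
  point need not exist; this is why the computation of the point is approximated in \<open>T\<close> steps.
\<close>

definition approx_point :: "baire \<Rightarrow> nat \<Rightarrow> nat \<Rightarrow> nat" where
  "approx_point s T n = run (\<lambda>i. Suc (enum_name s i)) (prog_code e2) n T"

text \<open>Approximates \<open>join (\<lambda>n. p (Suc n)) y\<close> for the name \<open>y\<close>
  computed from \<open>s\<close>: even queries are always answered, odd ones once \<open>e2\<close>
  finishes within \<open>T\<close> steps.\<close>

definition sim_oracle :: "baire \<Rightarrow> baire \<Rightarrow> nat \<Rightarrow> nat \<Rightarrow> nat" where
  "sim_oracle p s T n = (if even n then Suc (p (Suc (n div 2))) else approx_point s T (n div 2))"

definition sim :: "baire \<Rightarrow> baire \<Rightarrow> nat \<Rightarrow> nat \<Rightarrow> nat \<Rightarrow> nat" where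
  "sim p s T k t = run (sim_oracle p s T) (p 0) k t"

definition accept :: "baire \<Rightarrow> nat set \<Rightarrow> bool" where
  "accept p A \<longleftrightarrow> (\<exists>s T k t v. range s \<subseteq> insert 0 (Suc ` A) \<and> sim p s T k t = Suc (Suc v))"

text \<open>Finite use twice: the outer run queries finitely many positions, and each answer reads a
  finite prefix of \<open>s\<close>.\<close>

lemma sim_continuous:
  obtains m where "\<And>s'. \<forall>i<m. s' i = s i \<Longrightarrow> sim p s' T k t = sim p s T k t"
proof -
  obtain N where N: "\<And>h'. \<forall>i<N. h' i = sim_oracle p s T i \<Longrightarrow>
      run h' (p 0) k t = run (sim_oracle p s T) (p 0) k t"
    using run_continuous[of "sim_oracle p s T" "p 0" k t] by metis
  have "\<exists>m. \<forall>s'. (\<forall>i<m. s' i = s i) \<longrightarrow> sim_oracle p s' T n = sim_oracle p s T n" for n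
  proof -
    obtain m where m: "\<And>h'. \<forall>i<m. h' i = Suc (enum_name s i) \<Longrightarrow>
        run h' (prog_code e2) (n div 2) T = approx_point s T (n div 2)"
      unfolding approx_point_def
      using run_continuous[of "\<lambda>i. Suc (enum_name s i)" "prog_code e2" "n div 2" T] by metis
    have "approx_point s' T (n div 2) = approx_point s T (n div 2)" if "\<forall>i<m. s' i = s i" for s'
      unfolding approx_point_def[of s'] by (rule m) (simp add: enum_name_cong[OF that])
    then show ?thesis unfolding sim_oracle_def by metis
  qed
  then obtain m where m: "\<forall>s'. (\<forall>i<m. s' i = s i) \<longrightarrow> (\<forall>n<N. sim_oracle p s' T n = sim_oracle p s T n)"
    using uniform_prefix[of N s "\<lambda>n s'. sim_oracle p s' T n = sim_oracle p s T n"] by blast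
  have "sim p s' T k t = sim p s T k t" if "\<forall>i<m. s' i = s i" for s'
    unfolding sim_def using N m that by blast
  then show thesis by (rule that)
qed

lemma approx_point_eq:
  assumes "type2 e2 (enum_name s) = Some y"
  shows "approx_point s T n \<noteq> 0 \<Longrightarrow> approx_point s T n = Suc (y n)"
    and "\<exists>T. approx_point s T n = Suc (y n)"
proof -
  have y: "eval (enum_name s) e2 n = Some (y n)" using assms type2_eq_Some_iff by blast
  show "\<exists>T. approx_point s T n = Suc (y n)"
    using y unfolding eval_iff_run approx_point_def .
  assume "approx_point s T n \<noteq> 0"
  then obtain v where v: "approx_point s T n = Suc v" using not0_implies_Suc by blast
  then have "eval (enum_name s) e2 n = Some v" unfolding eval_iff_run approx_point_def by blast
  with y v show "approx_point s T n = Suc (y n)" by simp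
qed

text \<open>If \<open>s\<close> does yield a name \<open>y\<close>, the answers given are correct,
  so a result survives passage to the full oracle; conversely a result needs finitely many queries,
  all answered for large \<open>T\<close>.\<close>

lemma sim_iff_eval:
  assumes y: "type2 e2 (enum_name s) = Some y" and e: "p 0 = prog_code e"
  shows "(\<exists>T t. sim p s T k t = Suc v) \<longleftrightarrow> eval (join (\<lambda>n. p (Suc n)) y) e k = Some v"
proof
  let ?h = "\<lambda>i. Suc (join (\<lambda>n. p (Suc n)) y i)"
  show "eval (join (\<lambda>n. p (Suc n)) y) e k = Some v" if ex: "\<exists>T t. sim p s T k t = Suc v"
  proof -
    obtain T t where "sim p s T k t = Suc v" using ex by blast
    moreover have "?h i = sim_oracle p s T i" if "sim_oracle p s T i \<noteq> 0" for i
      using that approx_point_eq(1)[OF y, of T "i div 2"]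
      by (cases "even i") (simp_all add: sim_oracle_def join_def)
    ultimately have "run ?h (p 0) k t = Suc v"
      unfolding sim_def by (rule run_mono_oracle[rotated])
    then show ?thesis unfolding eval_iff_run e by blast
  qed
  assume "eval (join (\<lambda>n. p (Suc n)) y) e k = Some v"
  then obtain t where t: "run ?h (p 0) k t = Suc v" unfolding eval_iff_run e by blast
  obtain N where N: "\<And>h'. \<forall>i<N. h' i = ?h i \<Longrightarrow> run h' (p 0) k t = run ?h (p 0) k t"
    using run_continuous[of ?h "p 0" k t] by metis
  obtain T0 where T0: "\<And>n. approx_point s (T0 n) n = Suc (y n)"
    using approx_point_eq(2)[OF y] by metis
  \<comment> \<open>The sum bounds each \<open>T0 n\<close>, and longer runs keep their
    results.\<close>
  define T where "T = (\<Sum>n<N. T0 n)"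
  have "approx_point s T n = Suc (y n)" if "n < N" for n
  proof -
    have "T0 n \<le> T" unfolding T_def using that by (intro member_le_sum) auto
    then show ?thesis using T0[of n] run_mono_time unfolding approx_point_def by blast
  qed
  then have "\<forall>i<N. sim_oracle p s T i = ?h i"
    by (simp add: sim_oracle_def join_def)
  from N[OF this] t have "sim p s T k t = Suc v" unfolding sim_def by simp
  then show "\<exists>T t. sim p s T k t = Suc v" by blast
qed

text \<open>On enumerations of \<open>indices x\<close> the machine answers correctly; other
  admissible sequences reduce to these through a shared prefix.\<close>

lemma accept_iff:
  assumes V: "open_repr (repr_restrict \<rho> Y) p = Some V" and x: "x \<in> X" "x \<in> Y"
  shows "accept p (indices x) \<longleftrightarrow> x \<in> V"
proof -
  \<comment> \<open>In \<open>Suc (Suc v)\<close> one successor codes a finished run, the other a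
    nonzero symbol.\<close>
  have run: "(\<exists>T k t v. sim p s T k t = Suc (Suc v)) \<longleftrightarrow> x \<in> V"
    if s: "{i. Suc i \<in> range s} = indices x" for s
  proof -
    obtain y where y: "type2 e2 (enum_name s) = Some y" "\<rho> y = Some x"
      using point_of_enumeration[OF x(1) s] .
    have "repr_restrict \<rho> Y y = Some x" using y(2) x(2) by (simp add: repr_restrict_eq_Some_iff)
    then obtain z where z: "eta p y = Some z" "z \<noteq> (\<lambda>_. 0) \<longleftrightarrow> x \<in> V"
      using V unfolding open_repr_eq_Some_iff by blast
    obtain e where e: "p 0 = prog_code e" "type2 e (join (\<lambda>n. p (Suc n)) y) = Some z"
      using z(1) eta_eq_Some_iff by blast
    have "(\<exists>T t. sim p s T k t = Suc v) \<longleftrightarrow> z k = v" for k v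
      using sim_iff_eval[of s y p e, OF y(1) e(1)] e(2) unfolding type2_eq_Some_iff by simp
    then have "(\<exists>T k t v. sim p s T k t = Suc (Suc v)) \<longleftrightarrow> (\<exists>k v. z k = Suc v)" by blast
    also have "\<dots> \<longleftrightarrow> z \<noteq> (\<lambda>_. 0)" by (auto simp: fun_eq_iff gr0_conv_Suc)
    finally show ?thesis using z(2) by blast
  qed
  show ?thesis
  proof
    assume "accept p (indices x)"
    then obtain s T k t v where s: "range s \<subseteq> insert 0 (Suc ` indices x)" "sim p s T k t = Suc (Suc v)"
      unfolding accept_def by blast
    obtain m where m: "\<And>s'. \<forall>i<m. s' i = s i \<Longrightarrow> sim p s' T k t = sim p s T k t"
      using sim_continuous[of s p T k t] by metis
    have "\<forall>j<m. \<forall>i. s j = Suc i \<longrightarrow> i \<in> indices x"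
    proof (intro allI impI)
      fix j i assume "s j = Suc i"
      then have "Suc i \<in> range s" by (metis rangeI)
      with s(1) show "i \<in> indices x" by blast
    qed
    from extend_enumeration[OF this]
    obtain s' where s': "\<forall>i<m. s' i = s i" "{i. Suc i \<in> range s'} = indices x" by blast
    have "sim p s' T k t = Suc (Suc v)" using m[OF s'(1)] s(2) by simp
    with run[OF s'(2)] show "x \<in> V" by blast
  next
    assume "x \<in> V"
    obtain s :: baire where s: "{i. Suc i \<in> range s} = indices x"
      using ex_enumeration[of "indices x"] by blast
    have "range s \<subseteq> insert 0 (Suc ` indices x)"
      unfolding s[symmetric] by (auto simp: image_iff) (metis not0_implies_Suc)
    with run[OF s] \<open>x \<in> V\<close> show "accept p (indices x)" unfolding accept_def by blast
  qed
qed

section \<open>A search that recognises the extension independently of names\<close>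

text \<open>In the following, \<open>Q = join p q\<close> with \<open>\<rho> q = Some x\<close>; \<open>listing Q\<close> enumerates \<open>indices x\<close>.\<close>

definition index_name :: "baire \<Rightarrow> baire" where
  "index_name Q = (\<lambda>n. the (eval (\<lambda>i. Q (Suc (i + i))) e1 n))"

text \<open>Stage \<open>j = \<langle>i, \<langle>k, t\<rangle>\<rangle>\<close> watches output
  position \<open>k\<close> for \<open>t\<close> steps on the constant name of \<open>i\<close>.
  Subtracting 1 merges an unfinished run with the symbol 0.\<close>

definition listing :: "baire \<Rightarrow> baire" where
  "listing Q j = (
     if run (\<lambda>n. Suc (if even n then index_name Q (Suc (n div 2)) else pfst j))
          (index_name Q 0) (pfst (psnd j)) (psnd (psnd j)) - 1 = 0
     then 0 else Suc (pfst j))"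

text \<open>Every number codes an infinite sequence by repeated unpairing, and every finite sequence
  is a prefix of one of these.\<close>

definition entry :: "nat \<Rightarrow> baire" where
  "entry w n = pfst ((psnd ^^ n) w)"

text \<open>\<open>z\<close> packs a sequence code, \<open>T\<close>, \<open>k\<close> and
  \<open>t\<close>. The coded sequence selects stages of \<open>listing Q\<close>, so it is
  admissible by construction.\<close>

definition search :: "baire \<Rightarrow> baire" where
  "search Q z = sim (\<lambda>n. Q (n + n)) (\<lambda>l. listing Q (entry (pfst z) l))
     (pfst (psnd z)) (pfst (psnd (psnd z))) (psnd (psnd (psnd z))) - 1"

lemma ex_entry: "\<exists>w. \<forall>i<m. entry w i = f i"
proof (induction m arbitrary: f)
  case (Suc m)
  from Suc.IH[of "\<lambda>i. f (Suc i)"] obtain w where w: "\<forall>i<m. entry w i = f (Suc i)" ..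
  have "entry \<langle>f 0, w\<rangle> i = f i" if "i < Suc m" for i
    using that w by (cases i) (simp_all add: entry_def funpow_Suc_right del: funpow.simps(2))
  then show ?case by blast
qed simp

text \<open>The listing may vary with the name \<open>q\<close>, its range does not; this makes the
  outcome of the search independent of names.\<close>

lemma range_listing:
  assumes "\<rho> q = Some x"
  shows "range (listing (join p q)) = insert 0 (Suc ` indices x)"
proof -
  let ?Q = "join p q"
  obtain r where r: "type2 e1 q = Some r" "subbase_repr X B r = Some x"
    using e1 assms unfolding realizes_def by blast
  have "(\<lambda>i. ?Q (Suc (i + i))) = q" by (simp flip: mult_2)
  with r(1) have index: "index_name ?Q = r" by (simp add: index_name_def type2_eq_Some_iff)
  have opn: "open_repr nat_repr r = Some (indices x)"
    using r(2) subbase_repr_eq_Some_iff[OF inj] by blast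
  have listing: "listing ?Q \<langle>i, \<langle>k, t\<rangle>\<rangle> =
    (if run (\<lambda>n. Suc (join (\<lambda>n. r (Suc n)) (\<lambda>_. i) n)) (r 0) k t - 1 = 0 then 0 else Suc i)" for i k t
    unfolding listing_def index by (simp add: join_def cong: if_cong)
  have mem: "i \<in> indices x \<longleftrightarrow> (\<exists>k t. listing ?Q \<langle>i, \<langle>k, t\<rangle>\<rangle> = Suc i)" for i
  proof -
    obtain y where y: "eta r (\<lambda>_. i) = Some y" "y \<noteq> (\<lambda>_. 0) \<longleftrightarrow> i \<in> indices x"
      using opn nat_repr_def[of "\<lambda>_. i"] unfolding open_repr_eq_Some_iff by blast
    obtain e where e: "r 0 = prog_code e" "type2 e (join (\<lambda>n. r (Suc n)) (\<lambda>_. i)) = Some y"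
      using y(1) eta_eq_Some_iff by blast
    have "y k = v \<longleftrightarrow> (\<exists>t. run (\<lambda>n. Suc (join (\<lambda>n. r (Suc n)) (\<lambda>_. i) n)) (r 0) k t = Suc v)" for k v
      using e(2) eval_iff_run unfolding e(1) type2_eq_Some_iff by (metis option.inject)
    moreover have "y \<noteq> (\<lambda>_. 0) \<longleftrightarrow> (\<exists>k v. y k = Suc v)" by (auto simp: fun_eq_iff gr0_conv_Suc)
    moreover have "n - 1 \<noteq> 0 \<longleftrightarrow> (\<exists>v. n = Suc (Suc v))" for n :: nat by presburger
    ultimately show ?thesis unfolding listing y(2)[symmetric] by auto
  qed
  have decode: "\<exists>i k t. j = \<langle>i, \<langle>k, t\<rangle>\<rangle>" for j by (metis prod_decode_inverse surj_pair)
  have zero_or: "listing ?Q \<langle>i, \<langle>k, t\<rangle>\<rangle> = 0 \<or> listing ?Q \<langle>i, \<langle>k, t\<rangle>\<rangle> = Suc i" for i k t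
    unfolding listing by simp
  \<comment> \<open>A run of zero steps has not halted, so a blank always occurs.\<close>
  have "listing ?Q \<langle>0, \<langle>0, 0\<rangle>\<rangle> = 0" unfolding listing by (simp add: run_def)
  then have zero: "0 \<in> range (listing ?Q)" by (metis rangeI)
  have suc: "Suc i \<in> range (listing ?Q)" if "i \<in> indices x" for i
    using that mem by (metis rangeI)
  have elem: "listing ?Q j \<in> insert 0 (Suc ` indices x)" for j
  proof -
    obtain i k t where j: "j = \<langle>i, \<langle>k, t\<rangle>\<rangle>" using decode by blast
    show ?thesis
    proof (cases "listing ?Q j = 0")
      case False
      then have "listing ?Q j = Suc i" using zero_or[of i k t] by (simp add: j)
      moreover from this have "i \<in> indices x" unfolding mem j by blast
      ultimately show ?thesis by blast
    qed simp
  qed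
  show ?thesis
  proof (rule equalityI)
    show "range (listing ?Q) \<subseteq> insert 0 (Suc ` indices x)" by (rule image_subsetI) (rule elem)
    show "insert 0 (Suc ` indices x) \<subseteq> range (listing ?Q)"
      by (rule insert_subsetI[OF zero image_subsetI]) (rule suc)
  qed
qed

text \<open>An accepting run uses finitely many entries of its sequence, so some finite code
  \<open>w\<close> of stages reproduces it.\<close>

lemma search_iff_accept:
  assumes "\<rho> q = Some x"
  shows "search (join p q) \<noteq> (\<lambda>_. 0) \<longleftrightarrow> accept p (indices x)"
proof
  let ?Q = "join p q"
  have p: "(\<lambda>n. ?Q (n + n)) = p" by (simp flip: mult_2)
  show "accept p (indices x)" if nonzero: "search ?Q \<noteq> (\<lambda>_. 0)"
  proof -
    obtain z where "search ?Q z \<noteq> 0" using nonzero by blast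
    then have "\<exists>v. sim p (\<lambda>l. listing ?Q (entry (pfst z) l)) (pfst (psnd z))
        (pfst (psnd (psnd z))) (psnd (psnd (psnd z))) = Suc (Suc v)"
      unfolding search_def p by presburger
    moreover have "range (\<lambda>l. listing ?Q (entry (pfst z) l)) \<subseteq> insert 0 (Suc ` indices x)"
      unfolding range_listing[OF assms, of p, symmetric] by (simp add: image_subset_iff)
    ultimately show ?thesis unfolding accept_def by blast
  qed
  assume "accept p (indices x)"
  then obtain s T k t v where s: "range s \<subseteq> range (listing ?Q)" "sim p s T k t = Suc (Suc v)"
    unfolding accept_def range_listing[OF assms] by blast
  obtain m where m: "\<And>s'. \<forall>i<m. s' i = s i \<Longrightarrow> sim p s' T k t = sim p s T k t"
    using sim_continuous[of s p T k t] by metis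
  have "\<forall>i. \<exists>j. s i = listing ?Q j" using s(1) by (auto simp: image_subset_iff image_iff)
  then obtain f where f: "\<And>i. s i = listing ?Q (f i)" by metis
  obtain w where "\<forall>i<m. entry w i = f i" using ex_entry by blast
  then have "search ?Q \<langle>w, \<langle>T, \<langle>k, t\<rangle>\<rangle>\<rangle> = Suc v"
    using m[of "\<lambda>l. listing ?Q (entry w l)"] s(2) f by (simp add: search_def p)
  then show "search ?Q \<noteq> (\<lambda>_. 0)" by auto
qed

text \<open>The oracles carry a name in their odd half, which is where \<open>e1\<close> is known to
  halt.\<close>

lemma tc_search: "total_computable {join p q |p q. q \<in> dom \<rho>} search"
proof -
  let ?D = "{join p q |p q. q \<in> dom \<rho>}"
  have index: "total_computable ?D (\<lambda>Q n. index_name Q (f Q n))" if "total_computable ?D f" for f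
  proof (rule tc_comp[OF _ that], unfold index_name_def, rule tc_eval)
    show "total_computable ?D (\<lambda>Q i. Q (Suc (i + i)))" by (intro tc_intros)
    fix Q n assume "Q \<in> ?D"
    then obtain p q x where q: "Q = join p q" "\<rho> q = Some x" by blast
    then obtain r where "type2 e1 q = Some r" using e1 unfolding realizes_def by blast
    moreover have "(\<lambda>i. Q (Suc (i + i))) = q" by (simp add: q flip: mult_2)
    ultimately show "eval (\<lambda>i. Q (Suc (i + i))) e1 n \<noteq> None" by (simp add: type2_eq_Some_iff)
  qed
  have "total_computable ?D listing"
    unfolding listing_def[abs_def] by (intro tc_run tc_intros index)
  note listing = tc_comp[OF this]
  have funpow: "(g ^^ n) u = rec_nat u (\<lambda>_. g) n" for g :: "nat \<Rightarrow> nat" and n u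
    by (induction n) simp_all
  have entry: "total_computable ?D (\<lambda>Q n. entry (f Q n) (g Q n))"
    if "total_computable ?D f" "total_computable ?D g" for f g
    unfolding entry_def funpow by (intro tc_fst tc_rec tc_snd tc_id that)
  have enum_name: "enum_name s i = (if i = 0 then prog_code enum_prog else s (i - 1))" for s i
    by (cases i) (simp_all add: enum_name_def)
  show ?thesis
    unfolding search_def[abs_def] sim_def sim_oracle_def approx_point_def enum_name
    by (intro tc_run tc_intros listing entry)
qed

text \<open>The new name runs \<open>search\<close> with the whole old name, its machine code
  included, as oracle.\<close>

theorem open_subspace_reducible:
  "repr_reducible (open_repr (repr_restrict \<rho> Y)) (\<lambda>p. map_option (\<lambda>U. U \<inter> Y) (open_repr \<rho> p))"
proof -
  obtain c where c: "\<And>p q n. q \<in> dom \<rho> \<Longrightarrow> eval (join p q) c n = Some (search (join p q) n)"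
    using tc_search unfolding total_computable_def by blast
  have "total_computable UNIV (\<lambda>p n. if n = 0 then prog_code c else p (n - 1))"
    by (intro tc_intros)
  then obtain e where "\<And>p n. eval p e n = Some (if n = 0 then prog_code c else p (n - 1))"
    unfolding total_computable_def by blast
  then have e: "type2 e p = Some (case_nat (prog_code c) p)" for p
    unfolding type2_eq_Some_iff by (auto split: nat.split)
  have "\<exists>U. open_repr \<rho> (case_nat (prog_code c) p) = Some U \<and> U \<inter> Y = V"
    if V: "open_repr (repr_restrict \<rho> Y) p = Some V" for p V
  proof (intro exI conjI)
    \<comment> \<open>Defined through index sets, hence a set of points however the machine behaves
      off \<open>Y\<close>.\<close>
    let ?U = "{x \<in> X. accept p (indices x)}"
    show "open_repr \<rho> (case_nat (prog_code c) p) = Some ?U"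
      unfolding open_repr_eq_Some_iff
    proof (intro conjI allI impI)
      show "?U \<subseteq> ran \<rho>" using ran by blast
      fix q x assume q: "\<rho> q = Some x"
      then have "eta (case_nat (prog_code c) p) q = Some (search (join p q))"
        unfolding eta_case_nat type2_eq_Some_iff using c by blast
      moreover have "x \<in> X" using q ran by (auto simp: ran_def)
      ultimately show "\<exists>y. eta (case_nat (prog_code c) p) q = Some y \<and> (y \<noteq> (\<lambda>_. 0) \<longleftrightarrow> x \<in> ?U)"
        using search_iff_accept[OF q, of p] by simp
    qed
    have "V \<subseteq> X \<inter> Y" using V ran unfolding open_repr_eq_Some_iff ran_repr_restrict by blast
    then show "?U \<inter> Y = V" using accept_iff[OF V] by blast
  qed
  then have "realizes (open_repr (repr_restrict \<rho> Y))
      (\<lambda>p. map_option (\<lambda>U. U \<inter> Y) (open_repr \<rho> p)) (type2 e) (\<lambda>V. V)"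
    unfolding realizes_def e by auto
  then show ?thesis unfolding repr_reducible_def computable_map_def by blast
qed

end

text \<open>A realizer on \<open>X\<close> stays one on the smaller domain, so \<open>PQuery\<close>
  copies the name unchanged.\<close>

lemma open_reducible_subspace:
  "repr_reducible (\<lambda>p. map_option (\<lambda>U. U \<inter> Y) (open_repr \<rho> p)) (open_repr (repr_restrict \<rho> Y))"
proof -
  have "type2 PQuery p = Some p" for p by (simp add: type2_eq_Some_iff)
  moreover have "open_repr (repr_restrict \<rho> Y) p = Some (U \<inter> Y)" if "open_repr \<rho> p = Some U" for p U
    using that unfolding open_repr_eq_Some_iff ran_repr_restrict repr_restrict_eq_Some_iff by blast
  ultimately show ?thesis
    unfolding repr_reducible_def computable_map_def realizes_def
    by (intro exI[of _ PQuery]) auto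
qed

text \<open>A point of \<open>Y\<close> has the same indices for the traces
  \<open>B i \<inter> Y\<close> as for the sets \<open>B i\<close>.\<close>

lemma subbase_repr_subspace:
  assumes "inj_on (\<lambda>x. {i. x \<in> B i}) X" "Y \<subseteq> X"
  shows "inj_on (\<lambda>x. {i. x \<in> B i \<inter> Y}) Y"
    and "subbase_repr Y (\<lambda>i. B i \<inter> Y) p = Some x \<longleftrightarrow> subbase_repr X B p = Some x \<and> x \<in> Y"
proof -
  show inj: "inj_on (\<lambda>x. {i. x \<in> B i \<inter> Y}) Y"
    using inj_on_subset[OF assms] by (rule inj_on_cong[THEN iffD1, rotated]) auto
  show "subbase_repr Y (\<lambda>i. B i \<inter> Y) p = Some x \<longleftrightarrow> subbase_repr X B p = Some x \<and> x \<in> Y"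
    unfolding subbase_repr_eq_Some_iff[OF inj] subbase_repr_eq_Some_iff[OF assms(1)]
    using assms(2) by auto
qed

theorem theorem6p3:
  fixes X Y :: "'a set" and \<rho> :: "'a repr"
  assumes "represented_space X \<rho>"
    and "computably_second_countable X \<rho>"
    and "Y \<subseteq> X"
  shows "computably_second_countable Y (repr_restrict \<rho> Y) \<and>
         computably_sequential_subset Y X \<rho>"
proof -
  obtain B where B: "\<forall>i. B i \<subseteq> X" "final_topology \<rho> = topology_generated_by (range B)"
      "\<forall>x\<in>X. \<exists>i. x \<in> B i" "inj_on (\<lambda>x. {i. x \<in> B i}) X"
      "repr_equivalent \<rho> (subbase_repr X B)"
    using assms(2) unfolding computably_second_countable_def by blast
  obtain e1 e2 where e: "realizes \<rho> (subbase_repr X B) (type2 e1) (\<lambda>x. x)"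
      "realizes (subbase_repr X B) \<rho> (type2 e2) (\<lambda>x. x)"
    using B(5) unfolding repr_equivalent_def repr_reducible_def computable_map_def by blast
  have ran: "ran \<rho> = X" using assms(1) unfolding represented_space_def .
  interpret subbase_space X \<rho> B e1 e2
    by standard (fact ran B(4) e)+
  note sub = subbase_repr_subspace[OF B(4) assms(3)]
  \<comment> \<open>The realizers for \<open>X\<close> serve for \<open>Y\<close> unchanged, with
    the traces as subbase.\<close>
  have "realizes (repr_restrict \<rho> Y) (subbase_repr Y (\<lambda>i. B i \<inter> Y)) (type2 e1) (\<lambda>x. x)"
    "realizes (subbase_repr Y (\<lambda>i. B i \<inter> Y)) (repr_restrict \<rho> Y) (type2 e2) (\<lambda>x. x)"
    using e unfolding realizes_def sub(2) repr_restrict_eq_Some_iff by blast+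
  then have "repr_equivalent (repr_restrict \<rho> Y) (subbase_repr Y (\<lambda>i. B i \<inter> Y))"
    unfolding repr_equivalent_def repr_reducible_def computable_map_def by blast
  moreover have "represented_space Y (repr_restrict \<rho> Y)"
    unfolding represented_space_def ran_repr_restrict using ran assms(3) by blast
  moreover have "\<forall>x\<in>Y. \<exists>i. x \<in> B i \<inter> Y" using B(3) assms(3) by blast
  ultimately have "computably_second_countable Y (repr_restrict \<rho> Y)"
    unfolding computably_second_countable_def
    using final_topology_subspace[OF B(2,3) assms(3)] sub(1)
    by (intro conjI exI[of _ "\<lambda>i. B i \<inter> Y"]) auto
  moreover have "computably_sequential_subset Y X \<rho>"
    unfolding computably_sequential_subset_def repr_equivalent_def
    using assms(1,3) open_subspace_reducible open_reducible_subspace by blast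
  ultimately show ?thesis ..
qed

end
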